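(* Let $a>0$, $b>0$, $c\in(0,1)$, let $X=(X_t)_{t\ge0}$ be the tempered stable subordinator with parameters $(a,b;c)$, and let $\tilde X_t=\frac1t\int_0^t X_s\,\mathrm{d}s$ for $t>0$. Then for every $t>0$ the probability density function $f_{\tilde X_t}$ of $\tilde X_t$ is given, for all $x>0$, by $$f_{\tilde X_t}(x)=\frac{b\,e^{-atb^{c}\Gamma(-c)}}{\pi}\int_0^1\frac{1}{y^2}\exp\left(-atb^{c}\Gamma(-c-1)\left(y+\cos(\pi c)(1-y)\left(\tfrac1y-1\right)^{c}\right)-\frac{bx}{y}\right)\sin\left(atb^{c}\sin(\pi c)\Gamma(-c-1)(1-y)\left(\tfrac1y-1\right)^{c}\right)\mathrm{d}y.$$
   Context: For $a>0$, $b>0$, $c\in(0,1)$, the tempered stable subordinator with parameters $(a,b;c)$ is the (càdlàg, nondecreasing) Lévy process $X=(X_t)_{t\ge0}$, $X_0=0$ a.s., with marginal Laplace transform $\mathbb{E}e^{-uX_t}=\exp\left(at\,\Gamma(-c)\left((b+u)^c-b^c\right)\right)$ for $\mathrm{Re}\,u>-b$ (principal branches). $\Gamma(\cdot)$ is the gamma function. *)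

theory Defs
  imports "HOL-Probability.Probability"
begin

text \<open>
  The time index ranges over the reals; only times \<open>t \<ge> 0\<close> are constrained. Continuity in
  probability is not listed because it follows from the path regularity and the stationarity
  of the increments.
\<close>

locale levy_process = prob_space M for M :: "'a measure" +
  fixes X :: "real \<Rightarrow> 'a \<Rightarrow> real"
  assumes random_variable: "\<And>t. t \<ge> 0 \<Longrightarrow> X t \<in> borel_measurable M"
    and start_zero: "AE \<omega> in M. X 0 \<omega> = 0"
    and indep_increments: "\<And>(n :: nat) (\<tau> :: nat \<Rightarrow> real).
      0 \<le> \<tau> 0 \<Longrightarrow> (\<And>i. i < n \<Longrightarrow> \<tau> i < \<tau> (Suc i)) \<Longrightarrow>
      indep_vars (\<lambda>_. borel) (\<lambda>i \<omega>. X (\<tau> (Suc i)) \<omega> - X (\<tau> i) \<omega>) {..<n}"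
    and stationary_increments: "\<And>s t. s \<ge> 0 \<Longrightarrow> t \<ge> 0 \<Longrightarrow>
      distr M borel (\<lambda>\<omega>. X (s + t) \<omega> - X s \<omega>) = distr M borel (\<lambda>\<omega>. X t \<omega> - X 0 \<omega>)"
    and right_continuous: "\<And>\<omega> t. \<omega> \<in> space M \<Longrightarrow> t \<ge> 0 \<Longrightarrow>
      continuous (at_right t) (\<lambda>s. X s \<omega>)"
    and left_limits: "\<And>\<omega> t. \<omega> \<in> space M \<Longrightarrow> t > 0 \<Longrightarrow>
      \<exists>l. ((\<lambda>s. X s \<omega>) \<longlongrightarrow> l) (at_left t)"

text \<open>
  In the Laplace transform, \<open>powr\<close> on the complex numbers is the principal branch. The
  \<open>has_bochner_integral\<close> form states that the expectation exists and has the given value.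
\<close>

locale tempered_stable_subordinator = levy_process M X
  for M :: "'a measure" and X :: "real \<Rightarrow> 'a \<Rightarrow> real" +
  fixes a b c :: real
  assumes nondecreasing: "AE \<omega> in M. mono_on {0..} (\<lambda>s. X s \<omega>)"
    and laplace_transform: "\<And>(u :: complex) t. Re u > - b \<Longrightarrow> t \<ge> 0 \<Longrightarrow>
      has_bochner_integral M (\<lambda>\<omega>. exp (- u * complex_of_real (X t \<omega>)))
        (exp (complex_of_real (a * t * Gamma (- c)) *
          ((complex_of_real b + u) powr complex_of_real c
            - complex_of_real b powr complex_of_real c)))"

definition time_average :: "(real \<Rightarrow> 'a \<Rightarrow> real) \<Rightarrow> real \<Rightarrow> 'a \<Rightarrow> real" where
  "time_average X t \<omega> = 1 / t * (LBINT s:{0..t}. X s \<omega>)"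

end

theory Submission
  imports Defs "HOL-Complex_Analysis.Complex_Analysis" "HOL-Real_Asymp.Real_Asymp"
begin

text \<open>
  With \<open>K = a t \<Gamma>(-c-1) > 0\<close>, so that \<open>a t \<Gamma>(-c) = - K (c+1)\<close>, approximating the time average by
  averages over a grid and using independence of the increments gives the Laplace exponent
  \<open>\<Psi>(u) = K ((c+1) b\<^sup>c - ((b+u)\<^bsup>c+1\<^esup> - b\<^bsup>c+1\<^esup>) / u)\<close> of the average. On the imaginary axis
  \<open>exp \<Psi>\<close> decays like \<open>exp (- const |u|\<^sup>c)\<close>, so Fourier inversion yields a continuous density. Since
  \<open>\<Psi>\<close> is holomorphic in the open upper half plane and continuous up to the boundary, the inversion
  integral over the upper half of the imaginary axis can be rotated onto the negative real axis,
  where \<open>exp \<Psi>\<close> is real up to the branch point \<open>-b\<close>. The part beyond \<open>-b\<close> becomes the stated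
  integral under \<open>u = -b/y\<close>; the lower half plane contributes the complex conjugate.
\<close>

section \<open>Fourier inversion with an integrable characteristic function\<close>

text \<open>The principal branch dictates the upper half plane: on the negative axis its argument is
  \<open>pi\<close>, so powers are continuous up to that axis from above. One edge of the contour
  can thus lie on the cut itself, with no limit over shifted paths, and the branch point
  \<open>- b\<close> is harmless because a power with positive exponent tends to 0 there. The
  obstacle is growth. For \<open>cos (pi * c) < 0\<close> the real part of the exponent grows like a
  multiple of \<open>norm u powr c\<close> along the negative axis. As \<open>c < 1\<close>, the
  factor \<open>exp (u * x)\<close> wins there exactly because \<open>x > 0\<close>. On the
  imaginary axis this factor has modulus 1 and the decay must come from \<Psi> alone. It is found by
  reading \<Psi> as the mean of \<psi>, the exponent of \<open>X t\<close>, over the segment from 0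
  to \<open>u\<close>: there \<open>b + u * s\<close> has argument at most \<open>pi / 2\<close> in
  modulus. The same mean is what the grid averages converge to, since the increment over cell
  \<open>i\<close> of \<open>n\<close> enters with weight \<open>(n - i) / n\<close>.\<close>

lemma (in real_distribution) measure_Ioc_fourier:
  assumes int: "integrable lborel (char M)" and "a \<le> b"
    and "measure M {a} = 0" "measure M {b} = 0"
  shows "(CLBINT x:{a<..b}. 1 / (2 * pi) * (CLBINT t. iexp (-(t * x)) * char M t))
    = complex_of_real (measure M {a<..b})"
proof -
  let ?F = "\<lambda>x t. indicator {a<..b} x *\<^sub>R (iexp (-(t * x)) * char M t)"
  let ?k = "\<lambda>t. CLBINT x:{a<..b}. iexp (-(t * x))"
  have k: "?k t = (iexp (-(t * a)) - iexp (-(t * b))) / (\<i> * t)" if "t \<noteq> 0" for t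
  proof -
    have "(CLBINT x=a..b. iexp (-(t * x))) =
        iexp (-(t * b)) / (- (\<i> * t)) - iexp (-(t * a)) / (- (\<i> * t))"
    proof (rule interval_integral_FTC_finite)
      show "continuous_on {min a b..max a b} (\<lambda>x. iexp (-(t * x)))"
        by (intro continuous_intros)
      show "((\<lambda>x. iexp (-(t * x)) / (- (\<i> * t))) has_vector_derivative iexp (-(t * x)))
          (at x within {min a b..max a b})" for x
      proof -
        have "((\<lambda>z. exp (- (\<i> * (t * z))) / (- (\<i> * t))) has_field_derivative
            exp (- (\<i> * (t * x)))) (at (complex_of_real x))"
          using that by (auto intro!: derivative_eq_intros simp: field_simps)
        from has_vector_derivative_real_field[OF this] show ?thesis
          by simp
      qed
    qed
    then show ?thesis
      using \<open>a \<le> b\<close> by (simp add: interval_integral_Ioc diff_divide_distrib field_simps)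
  qed
  have kb: "norm (?k t) \<le> b - a" for t
  proof -
    have "norm (?k t) \<le> (LBINT x. norm (indicator {a<..b} x *\<^sub>R iexp (-(t * x))))"
      unfolding set_lebesgue_integral_def by (rule integral_norm_bound)
    also have "\<dots> = (LBINT x. indicator {a<..b} x)"
      by (intro Bochner_Integration.integral_cong) auto
    finally show ?thesis using \<open>a \<le> b\<close> by simp
  qed
  have [measurable]: "?k \<in> borel_measurable borel"
    unfolding set_lebesgue_integral_def by measurable
  \<comment> \<open>The truncation matches the symmetric limit in \<open>Levy_Inversion\<close>. The
    kernel \<open>?k\<close> is bounded by \<open>b - a\<close>, so integrability of
    \<open>char M\<close> supplies the dominating function.\<close>
  have "(\<lambda>n::nat. CLBINT t. indicator {-real n<..real n} t *\<^sub>R (?k t * char M t))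
      \<longlonglongrightarrow> (CLBINT t. ?k t * char M t)"
  proof (rule integral_dominated_convergence[where w="\<lambda>t. (b - a) * norm (char M t)"])
    show "integrable lborel (\<lambda>t. (b - a) * norm (char M t))"
      using int by simp
    show "AE t in lborel. (\<lambda>n. indicator {- real n<..real n} t *\<^sub>R (?k t * char M t))
        \<longlonglongrightarrow> ?k t * char M t"
    proof (rule AE_I2)
      fix t :: real
      obtain N :: nat where N: "\<bar>t\<bar> < N" using reals_Archimedean2 by blast
      have "\<forall>\<^sub>F n in sequentially. ?k t * char M t =
          indicator {- real n<..real n} t *\<^sub>R (?k t * char M t)"
        by (rule eventually_mono[OF eventually_ge_at_top[of N]]) (use N in \<open>auto simp: indicator_def\<close>)
      then show "(\<lambda>n. indicator {- real n<..real n} t *\<^sub>R (?k t * char M t)) \<longlonglongrightarrow> ?k t * char M t"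
        by (rule Lim_transform_eventually[OF tendsto_const])
    qed
    show "AE t in lborel. norm (indicator {- real n<..real n} t *\<^sub>R (?k t * char M t))
        \<le> (b - a) * norm (char M t)" for n :: nat
      using kb \<open>a \<le> b\<close> by (intro AE_I2) (auto simp: norm_mult split: split_indicator intro!: mult_right_mono)
  qed measurable
  moreover have "(CLBINT t. indicator {-real n<..real n} t *\<^sub>R (?k t * char M t)) =
      (CLBINT t=-real n..real n. (iexp (-(t * a)) - iexp (-(t * b))) / (\<i> * t) * char M t)" for n
  proof -
    have "(CLBINT t=-real n..real n. (iexp (-(t * a)) - iexp (-(t * b))) / (\<i> * t) * char M t)
      = (CLBINT t. indicator {-real n<..real n} t *\<^sub>R
          ((iexp (-(t * a)) - iexp (-(t * b))) / (\<i> * t) * char M t))"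
      using interval_integral_Ioc[of "- real n" "real n"] by (simp add: set_lebesgue_integral_def)
    \<comment> \<open>At \<open>t = 0\<close> the quotient is 0 by the division convention while
      \<open>?k 0 = b - a\<close>, so the integrands agree only almost everywhere.\<close>
    also have "\<dots> = (CLBINT t. indicator {-real n<..real n} t *\<^sub>R (?k t * char M t))"
    proof (rule integral_cong_AE)
      show "AE t in lborel. indicator {-real n<..real n} t *\<^sub>R
          ((iexp (-(t * a)) - iexp (-(t * b))) / (\<i> * t) * char M t) =
          indicator {-real n<..real n} t *\<^sub>R (?k t * char M t)"
        using AE_lborel_singleton[of 0] by eventually_elim (simp only: k not_False_eq_True)
    qed measurable
    finally show ?thesis by simp
  qed
  ultimately have "(\<lambda>n::nat. 1 / (2 * pi) *
      (CLBINT t=-real n..real n. (iexp (-(t * a)) - iexp (-(t * b))) / (\<i> * t) * char M t))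
      \<longlonglongrightarrow> 1 / (2 * pi) * (CLBINT t. ?k t * char M t)"
    by (intro tendsto_mult tendsto_const) simp
  moreover have "(\<lambda>n::nat. 1 / (2 * pi) *
      (CLBINT t=-real n..real n. (iexp (-(t * a)) - iexp (-(t * b))) / (\<i> * t) * char M t))
      \<longlonglongrightarrow> complex_of_real (measure M {a<..b})"
    using Levy_Inversion[OF assms(2-4)] by simp
  ultimately have "complex_of_real (measure M {a<..b}) = 1 / (2 * pi) * (CLBINT t. ?k t * char M t)"
    by (rule LIMSEQ_unique[rotated])
  also have "(CLBINT t. ?k t * char M t) = (CLBINT t. CLBINT x. ?F x t)"
    unfolding set_lebesgue_integral_def
    by (intro Bochner_Integration.integral_cong refl, subst integral_mult_left_zero[symmetric]) 
       (simp add: mult.assoc)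
  also have "\<dots> = (CLBINT x. CLBINT t. ?F x t)"
  proof (rule lborel_pair.Fubini_integral, rule lborel_pair.Fubini_integrable)
    show "integrable lborel (\<lambda>x. LBINT t. norm (case (x, t) of (x, t) \<Rightarrow> ?F x t))"
      using \<open>a \<le> b\<close> by (auto simp: norm_mult intro!: disjI2 integrable_real_indicator)
    show "AE x in lborel. integrable lborel (\<lambda>t. case (x, t) of (x, t) \<Rightarrow> ?F x t)"
    proof (rule AE_I2)
      fix x
      show "integrable lborel (\<lambda>t. case (x, t) of (x, t) \<Rightarrow> ?F x t)"
        by (rule Bochner_Integration.integrable_bound[OF int])
           (auto simp: norm_mult split: split_indicator)
    qed
  qed measurable
  also have "\<dots> = (CLBINT x:{a<..b}. (CLBINT t. iexp (-(t * x)) * char M t))"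
    unfolding set_lebesgue_integral_def by simp
  finally show ?thesis by simp
qed

text \<open>For a characteristic function the integral is real by conjugation symmetry, so taking
  \<open>Re\<close> loses nothing and only fixes the type.\<close>

definition fourier_density :: "(real \<Rightarrow> complex) \<Rightarrow> real \<Rightarrow> real" where
  "fourier_density \<phi> x = 1 / (2 * pi) * Re (CLBINT t. iexp (-(t * x)) * \<phi> t)"

lemma isCont_fourier_integral:
  fixes \<phi> :: "real \<Rightarrow> complex"
  assumes int: "integrable lborel \<phi>"
  shows "isCont (\<lambda>x. CLBINT t. iexp (-(t * x)) * \<phi> t) x"
  unfolding continuous_at_sequentially
proof safe
  fix X :: "nat \<Rightarrow> real" assume X: "X \<longlonglongrightarrow> x"
  have [measurable]: "\<phi> \<in> borel_measurable borel"
    using borel_measurable_integrable[OF int] by simp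
  show "((\<lambda>x. CLBINT t. iexp (-(t * x)) * \<phi> t) \<circ> X) \<longlonglongrightarrow> (CLBINT t. iexp (-(t * x)) * \<phi> t)"
    unfolding o_def
  proof (rule integral_dominated_convergence[where w="\<lambda>t. norm (\<phi> t)"])
    show "AE t in lborel. (\<lambda>n. iexp (-(t * X n)) * \<phi> t) \<longlonglongrightarrow> iexp (-(t * x)) * \<phi> t"
      using X by (intro AE_I2 tendsto_intros)
  qed (use int in \<open>auto simp: norm_mult\<close>)
qed

lemma isCont_fourier_density:
  assumes "integrable lborel \<phi>"
  shows "isCont (fourier_density \<phi>) x"
  using isCont_fourier_integral[OF assms, of x]
  unfolding fourier_density_def isCont_def by (intro tendsto_intros)

lemma fourier_density_bounded:
  assumes int: "integrable lborel \<phi>"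
  shows "\<bar>fourier_density \<phi> x\<bar> \<le> (LBINT t. norm (\<phi> t))"
proof -
  have "\<bar>Re (CLBINT t. iexp (-(t * x)) * \<phi> t)\<bar> \<le> norm (CLBINT t. iexp (-(t * x)) * \<phi> t)"
    by (rule abs_Re_le_cmod)
  also have "\<dots> \<le> (LBINT t. norm (iexp (-(t * x)) * \<phi> t))"
    by (rule integral_norm_bound)
  also have "\<dots> = (LBINT t. norm (\<phi> t))"
    by (simp add: norm_mult)
  finally have *: "\<bar>Re (CLBINT t. iexp (-(t * x)) * \<phi> t)\<bar> \<le> (LBINT t. norm (\<phi> t))" .
  have "1 / (2 * pi) * \<bar>Re (CLBINT t. iexp (-(t * x)) * \<phi> t)\<bar> \<le> 1 * (LBINT t. norm (\<phi> t))"
    using pi_gt3 by (intro mult_mono *) auto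
  then show ?thesis by (simp add: fourier_density_def abs_mult)
qed

text \<open>Inversion is first available only for intervals whose endpoints are not atoms. Atoms are
  countable, so such endpoints exist arbitrarily close to any point; the bound on the density then
  makes short intervals light, which excludes atoms altogether. Continuity upgrades nonnegative
  interval masses to a density that is nonnegative everywhere.\<close>

lemma (in real_distribution) density_of_integrable_char:
  assumes int: "integrable lborel (char M)"
  shows "M = density lborel (\<lambda>x. ennreal (fourier_density (char M) x))"
    and "fourier_density (char M) x \<ge> 0"
proof -
  let ?f = "fourier_density (char M)"
  have cont: "continuous_on A ?f" for A
    by (intro continuous_at_imp_continuous_on ballI isCont_fourier_density int)
  have [measurable]: "?f \<in> borel_measurable borel"
    by (rule borel_measurable_continuous_onI[OF cont])
  have si: "set_integrable lborel {a<..b} ?f" for a b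
    by (rule set_integrable_subset[OF borel_integrable_atLeastAtMost'[OF cont[of "{a..b}"]]]) auto
  have sic: "set_integrable lborel {a<..b} (\<lambda>x. CLBINT t. iexp (-(t * x)) * char M t)" for a b
    by (intro set_integrable_subset[OF borel_integrable_atLeastAtMost'[of a b]]
        continuous_at_imp_continuous_on ballI isCont_fourier_integral int) auto
  have sicst: "set_integrable lborel {a<..b} (\<lambda>_. k)" for a b k :: real
    by (intro set_integrable_subset[OF borel_integrable_atLeastAtMost'[of a b]] continuous_on_const) auto
  have csti: "(LBINT x:{a<..b}. k) = k * (b - a)" if "a \<le> b" for a b k :: real
    using that by (simp add: set_lebesgue_integral_def)
  have Ioc': "measure M {a<..b} = (LBINT x:{a<..b}. ?f x)"
    if "a \<le> b" "measure M {a} = 0" "measure M {b} = 0" for a b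
  proof -
    have "measure M {a<..b} = Re (CLBINT x:{a<..b}. 1 / (2 * pi) * (CLBINT t. iexp (-(t * x)) * char M t))"
      by (subst measure_Ioc_fourier[OF int that]) simp
    also have "\<dots> = (LBINT x:{a<..b}. Re (1 / (2 * pi) * (CLBINT t. iexp (-(t * x)) * char M t)))"
      using sic[of a b] unfolding set_lebesgue_integral_def set_integrable_def
      by (subst integral_Re[symmetric])
         (auto simp: scaleR_conv_of_real mult.left_commute intro!: Bochner_Integration.integral_cong)
    also have "\<dots> = (LBINT x:{a<..b}. ?f x)"
      by (simp add: fourier_density_def Re_divide_of_real)
    finally show ?thesis .
  qed
  define B where "B = (LBINT t. norm (char M t)) + 1"
  have B: "\<bar>?f x\<bar> \<le> B" "B > 0" for x
    using fourier_density_bounded[OF int, of x] unfolding B_def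
    by (auto intro!: add_nonneg_pos)
  have bound: "(LBINT x:{a<..b}. ?f x) \<le> B * (b - a)" if "a \<le> b" for a b
  proof -
    have "(LBINT x:{a<..b}. ?f x) \<le> (LBINT x:{a<..b}. B)"
      using B by (intro set_integral_mono si sicst) (auto simp: abs_le_iff)
    then show ?thesis using that by (simp add: csti)
  qed
  have atom: "measure M {x} = 0" for x
  proof (rule ccontr)
    assume "measure M {x} \<noteq> 0"
    then have m: "measure M {x} > 0" by (simp add: zero_less_measure_iff)
    \<comment> \<open>Chosen so that an interval of length below \<open>2 * d\<close> around
      \<open>x\<close> has mass less than the supposed atom.\<close>
    define d where "d = measure M {x} / (2 * B + 1)"
    have d: "d > 0" "2 * B * d < measure M {x}"
      using m B by (auto simp: d_def field_simps)
    obtain u where u: "u \<in> {x - d<..<x}" "u \<notin> {x. measure M {x} \<noteq> 0}"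
      using open_minus_countable[OF countable_support, of "{x - d<..<x}"] d by auto
    obtain v where v: "v \<in> {x<..<x + d}" "v \<notin> {x. measure M {x} \<noteq> 0}"
      using open_minus_countable[OF countable_support, of "{x<..<x + d}"] d by auto
    have "measure M {x} \<le> measure M {u<..v}"
      using u v by (intro finite_measure_mono) auto
    also have "\<dots> \<le> B * (v - u)"
      using Ioc'[of u v] bound[of u v] u v by auto
    also have "\<dots> \<le> B * (2 * d)"
      using u v B by (intro mult_left_mono) auto
    finally show False using d by simp
  qed
  have Ioc: "measure M {a<..b} = (LBINT x:{a<..b}. ?f x)" if "a \<le> b" for a b
    using Ioc' atom that by blast
  show nonneg: "?f x \<ge> 0" for x
  proof (rule ccontr)
    assume "\<not> ?f x \<ge> 0"
    then have neg: "?f x < 0" by simp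
    have "\<forall>\<^sub>F y in at_right x. ?f y < ?f x / 2"
      using isCont_fourier_density[OF int, of x] neg
      by (intro order_tendstoD(2)[of _ "?f x"])
         (auto simp: continuous_within intro: filterlim_mono[OF _ order_refl at_le])
    then obtain c where c: "c > x" "\<And>y. x < y \<Longrightarrow> y < c \<Longrightarrow> ?f y < ?f x / 2"
      by (auto simp: eventually_at_right_field)
    define d where "d = (x + c) / 2"
    have d: "x < d" "d < c" using c by (auto simp: d_def)
    have "(LBINT x:{x<..d}. ?f x) \<le> (LBINT y:{x<..d}. ?f x / 2)"
    proof (intro set_integral_mono si)
      show "?f y \<le> ?f x / 2" if "y \<in> {x<..d}" for y
        using c(2)[of y] d that by simp
    qed (rule sicst)
    also have "\<dots> = ?f x / 2 * (d - x)"
      using d by (simp add: csti)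
    also have "\<dots> < 0"
      using neg d by (intro mult_neg_pos) auto
    finally show False
      using Ioc[of x d] d measure_nonneg[of M "{x<..d}"] by linarith
  qed
  show "M = density lborel (\<lambda>x. ennreal (?f x))"
  proof (rule measure_eqI_generator_eq[where \<Omega>=UNIV and E="range (\<lambda>(a, b). {a<..b::real})"
        and A="\<lambda>n::nat. {-real n<..real n}"])
    fix X assume "X \<in> range (\<lambda>(a, b). {a<..b::real})"
    then obtain a b where X: "X = {a<..b}" by auto
    have "emeasure (density lborel (\<lambda>x. ennreal (?f x))) {a<..b} =
        (\<integral>\<^sup>+x. ennreal (indicator {a<..b} x *\<^sub>R ?f x) \<partial>lborel)"
      by (subst emeasure_density) (auto intro!: nn_integral_cong split: split_indicator)
    also have "\<dots> = ennreal (LBINT x:{a<..b}. ?f x)"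
      unfolding set_lebesgue_integral_def using si[of a b] nonneg
      by (intro nn_integral_eq_integral) (auto simp: set_integrable_def)
    also have "\<dots> = emeasure M {a<..b}"
      by (cases "a \<le> b") (simp_all add: Ioc emeasure_eq_measure set_lebesgue_integral_def)
    finally show "emeasure M X = emeasure (density lborel (\<lambda>x. ennreal (?f x))) X"
      using X by simp
  qed (auto simp: Int_stable_def emeasure_eq_measure borel_sigma_sets_Ioc UN_Ioc_eq_UNIV)
qed

section \<open>Riemann sums of right-continuous functions\<close>

text \<open>One-sided limits bound the function near each point, and bisection passes from local to
  global boundedness.\<close>

lemma cadlag_bounded:
  fixes f :: "real \<Rightarrow> real"
  assumes "0 \<le> T"
    and rc: "\<And>t. t \<ge> 0 \<Longrightarrow> continuous (at_right t) f"
    and ll: "\<And>t. t > 0 \<Longrightarrow> \<exists>l. (f \<longlongrightarrow> l) (at_left t)"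
  shows "bounded (f ` {0..T})"
proof -
  \<comment> \<open>The local step at 0 also quantifies over intervals reaching below 0, where
    nothing is known about \<open>f\<close>; intersecting with \<open>S\<close> discards that
    part.\<close>
  define S where "S = {0::real..}"
  have "bounded (f ` ({0..T} \<inter> S))"
    using \<open>0 \<le> T\<close>
  proof (induction rule: Bolzano)
    case (trans a b c)
    have "{a..c} \<inter> S = ({a..b} \<inter> S) \<union> ({b..c} \<inter> S)"
      using trans by auto
    then show ?case using trans(1,2) by (simp only: image_Un bounded_Un)
  next
    case (local x)
    define K where "K = norm (f x) + 1"
    have "\<forall>\<^sub>F y in at_right x. norm (f y) < K"
      using rc[of x] local
      by (intro order_tendstoD(2)[OF tendsto_norm]) (auto simp: continuous_within K_def)
    then obtain u where u: "u > x" "\<And>y. x < y \<Longrightarrow> y < u \<Longrightarrow> norm (f y) < K"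
      by (auto simp: eventually_at_right_field)
    obtain L v where v: "v < x" "\<And>y. v < y \<Longrightarrow> y < x \<Longrightarrow> 0 \<le> y \<Longrightarrow> norm (f y) \<le> L"
    proof (cases "x > 0")
      case True
      then obtain l where "(f \<longlongrightarrow> l) (at_left x)" using ll by blast
      then have "\<forall>\<^sub>F y in at_left x. norm (f y) < norm l + 1"
        by (intro order_tendstoD(2)[OF tendsto_norm]) auto
      then obtain v where "v < x" "\<And>y. v < y \<Longrightarrow> y < x \<Longrightarrow> norm (f y) < norm l + 1"
        by (auto simp: eventually_at_left_field)
      then show ?thesis by (intro that[of v "norm l + 1"]) (auto intro: less_imp_le)
    next
      case False
      then show ?thesis using local by (intro that[of "x - 1" 0]) auto
    qed
    let ?B = "max (norm (f x)) (max K L)"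
    have "\<forall>a b. a \<le> x \<and> x \<le> b \<and> b - a < min (u - x) (x - v) \<longrightarrow> bounded (f ` ({a..b} \<inter> S))"
    proof (intro allI impI)
      fix a b assume ab: "a \<le> x \<and> x \<le> b \<and> b - a < min (u - x) (x - v)"
      have "norm (f y) \<le> ?B" if "y \<in> {a..b} \<inter> S" for y
        using u(2)[of y] v(2)[of y] ab that by (cases y x rule: linorder_cases) (auto simp: S_def)
      then show "bounded (f ` ({a..b} \<inter> S))"
        by (intro boundedI[where B="?B"]) blast
    qed
    then show ?case
      using u v by (intro exI[of _ "min (u - x) (x - v)"]) auto
  qed
  moreover have "{0..T} \<inter> S = {0..T}" by (auto simp: S_def)
  ultimately show ?thesis by simp
qed

text \<open>The sum over right endpoints is the integral of a step function. Its nodes approach each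
  \<open>s\<close> from the right, so right continuity gives pointwise convergence and
  \<open>B\<close> dominates. It serves both for the paths of the process and for the deterministic
  exponent.\<close>

lemma riemann_sum_right_continuous:
  fixes g :: "real \<Rightarrow> 'a :: {banach, second_countable_topology}"
  assumes "t > 0"
    and rc: "\<And>s. 0 \<le> s \<Longrightarrow> s < t \<Longrightarrow> continuous (at_right s) g"
    and bdd: "\<And>s. 0 \<le> s \<Longrightarrow> s \<le> t \<Longrightarrow> norm (g s) \<le> B"
  shows "(\<lambda>n. (t / real n) *\<^sub>R (\<Sum>k=1..n. g (real k * t / real n)))
    \<longlonglongrightarrow> (LBINT s:{0..t}. g s)"
proof -
  define J where "J n k = {(real k - 1) * t / real n <.. real k * t / real n}" for n k :: nat
  define h where "h n s = indicator {0} s *\<^sub>R g 0 +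
      (\<Sum>k=1..n. indicator (J n k) s *\<^sub>R g (real k * t / real n))" for n :: nat and s
  have [measurable]: "J n k \<in> sets borel" for n k by (simp add: J_def)
  have [measurable]: "h n \<in> borel_measurable borel" for n
    unfolding h_def by measurable
  have step: "h n s = g (real (nat \<lceil>real n * s / t\<rceil>) * t / real n)"
    if s: "0 < s" "s \<le> t" and "n > 0" for n s
  proof -
    have eq: "s \<in> J n k \<longleftrightarrow> k = nat \<lceil>real n * s / t\<rceil>" if "k \<ge> 1" for k
    proof -
      have "s \<in> J n k \<longleftrightarrow> real k - 1 < real n * s / t \<and> real n * s / t \<le> real k"
        using \<open>t > 0\<close> \<open>n > 0\<close> by (auto simp: J_def field_simps)
      also have "\<dots> \<longleftrightarrow> \<lceil>real n * s / t\<rceil> = int k"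
        by (simp add: ceiling_eq_iff)
      also have "\<dots> \<longleftrightarrow> k = nat \<lceil>real n * s / t\<rceil>"
        using that by auto
      finally show ?thesis .
    qed
    have "real n * s / t \<le> real n" using that \<open>t > 0\<close> by (simp add: field_simps)
    moreover have "real n * s / t > 0" using that \<open>t > 0\<close> by simp
    ultimately have m: "nat \<lceil>real n * s / t\<rceil> \<in> {1..n}"
      by (auto simp: ceiling_le_iff nat_le_iff le_nat_iff less_ceiling_iff)
    have "h n s = (\<Sum>k=1..n. if k = nat \<lceil>real n * s / t\<rceil> then g (real k * t / real n) else 0)"
    proof -
      have "(\<Sum>k=1..n. indicator (J n k) s *\<^sub>R g (real k * t / real n)) =
          (\<Sum>k=1..n. if k = nat \<lceil>real n * s / t\<rceil> then g (real k * t / real n) else 0)"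
        by (intro sum.cong refl) (simp add: indicator_def eq)
      then show ?thesis unfolding h_def using s by simp
    qed
    then show ?thesis using m by (simp only: sum.delta finite_atLeastAtMost if_True)
  qed
  have node: "s \<le> real (nat \<lceil>real n * s / t\<rceil>) * t / real n"
      "real (nat \<lceil>real n * s / t\<rceil>) * t / real n \<le> s + t / real n"
      "real (nat \<lceil>real n * s / t\<rceil>) * t / real n \<le> t"
    if s: "0 < s" "s \<le> t" and "n > 0" for n s
  proof -
    have n: "real (nat \<lceil>real n * s / t\<rceil>) = of_int \<lceil>real n * s / t\<rceil>"
      using that \<open>t > 0\<close> by (simp add: ceiling_le_iff le_ceiling_iff)
    have "real n * s / t \<le> of_int \<lceil>real n * s / t\<rceil>" by simp
    then have "real n * s \<le> of_int \<lceil>real n * s / t\<rceil> * t"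
      by (simp only: pos_divide_le_eq[OF \<open>t > 0\<close>])
    then show "s \<le> real (nat \<lceil>real n * s / t\<rceil>) * t / real n"
      unfolding n using that by (subst pos_le_divide_eq) (auto simp: mult.commute)
    have "of_int \<lceil>real n * s / t\<rceil> \<le> real n * s / t + 1" by linarith
    then show "real (nat \<lceil>real n * s / t\<rceil>) * t / real n \<le> s + t / real n"
      unfolding n using that \<open>t > 0\<close> by (simp add: field_simps)
    have "real n * s / t \<le> real n" using that \<open>t > 0\<close> by (simp add: field_simps)
    then have "\<lceil>real n * s / t\<rceil> \<le> int n" by (simp add: ceiling_le_iff)
    then show "real (nat \<lceil>real n * s / t\<rceil>) * t / real n \<le> t"
      unfolding n using that \<open>t > 0\<close> by (simp add: field_simps)
  qed
  have outside: "h n s = 0" if "s \<notin> {0..t}" for n s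
  proof -
    have "s \<notin> J n k" if "k \<in> {1..n}" for k
    proof -
      have "0 \<le> (real k - 1) * t / real n" "real k * t / real n \<le> t"
        using that \<open>t > 0\<close> by (auto simp: field_simps)
      then show ?thesis using \<open>s \<notin> {0..t}\<close> by (auto simp: J_def)
    qed
    then show ?thesis using that \<open>t > 0\<close> by (auto simp: h_def)
  qed
  have zero: "h n 0 = g 0" for n
  proof -
    have "0 \<notin> J n k" if "k \<in> {1..n}" for k
    proof -
      have "0 \<le> (real k - 1) * t / real n"
        using that \<open>t > 0\<close> by auto
      then show ?thesis by (auto simp: J_def)
    qed
    then show ?thesis by (auto simp: h_def)
  qed
  have lim: "(\<lambda>n. h n s) \<longlonglongrightarrow> indicator {0..t} s *\<^sub>R g s" for s
  proof -
    consider "s \<notin> {0..t}" | "s = 0" | "s = t" | "0 < s" "s < t" by fastforce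
    then show ?thesis
    proof cases
      case 3
      have "\<forall>\<^sub>F n in sequentially. g t = h n t"
        using eventually_gt_at_top[of 0] by eventually_elim (use \<open>t > 0\<close> in \<open>simp add: step\<close>)
      then show ?thesis using 3 \<open>t > 0\<close>
        by (auto intro: Lim_transform_eventually[OF tendsto_const])
    next
      case 4
      let ?x = "\<lambda>n. real (nat \<lceil>real n * s / t\<rceil>) * t / real n"
      have x: "?x \<longlonglongrightarrow> s"
      proof (rule tendsto_sandwich)
        show "\<forall>\<^sub>F n in sequentially. s \<le> ?x n"
          using eventually_gt_at_top[of 0] by eventually_elim (use 4 node in auto)
        show "\<forall>\<^sub>F n in sequentially. ?x n \<le> s + t / real n"
          using eventually_gt_at_top[of 0] by eventually_elim (use 4 node in auto)
        show "(\<lambda>n. s + t / real n) \<longlonglongrightarrow> s"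
          using tendsto_add[OF tendsto_const[of s] lim_const_over_n[of t]] by simp
      qed simp
      \<comment> \<open>A node may coincide with \<open>s\<close>, so the limit is needed within the
        closed half line rather than \<open>at_right s\<close>.\<close>
      have "continuous (at s within {s..}) g"
        using rc[of s] 4 by (simp add: continuous_within at_within_Ici_at_right)
      then have "(\<lambda>n. g (?x n)) \<longlonglongrightarrow> g s"
      proof (rule continuous_within_tendsto_compose)
        show "\<forall>\<^sub>F n in sequentially. ?x n \<in> {s..}"
          using eventually_gt_at_top[of 0] by eventually_elim (use 4 node in auto)
      qed (rule x)
      moreover have "\<forall>\<^sub>F n in sequentially. g (?x n) = h n s"
        using eventually_gt_at_top[of 0] by eventually_elim (use 4 in \<open>simp add: step\<close>)
      ultimately show ?thesis using 4 by (auto intro: Lim_transform_eventually)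
    qed (use \<open>t > 0\<close> in \<open>auto simp: outside zero\<close>)
  qed
  \<comment> \<open>\<open>step\<close> and \<open>node\<close> require a positive number of cells,
    hence the shifted index.\<close>
  have "(\<lambda>n. LBINT s. h (Suc n) s) \<longlonglongrightarrow> (LBINT s. indicator {0..t} s *\<^sub>R g s)"
  proof (rule integral_dominated_convergence[where w="\<lambda>s. indicator {0..t} s * B"])
    show "(\<lambda>s. indicator {0..t} s *\<^sub>R g s) \<in> borel_measurable lborel"
      by (rule borel_measurable_LIMSEQ_metric[of h]) (use lim in auto)
    show "integrable lborel (\<lambda>s. indicator {0..t} s * B)"
      using \<open>t > 0\<close> by (intro integrable_mult_left integrable_real_indicator) auto
    show "AE s in lborel. (\<lambda>n. h (Suc n) s) \<longlonglongrightarrow> indicator {0..t} s *\<^sub>R g s"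
      using lim by (intro AE_I2 LIMSEQ_Suc)
    show "AE s in lborel. norm (h (Suc n) s) \<le> indicator {0..t} s * B" for n
    proof (rule AE_I2)
      fix s
      consider "s \<notin> {0..t}" | "s = 0" | "0 < s" "s \<le> t" by fastforce
      then show "norm (h (Suc n) s) \<le> indicator {0..t} s * B"
      proof cases
        case 3
        then have "norm (g (real (nat \<lceil>real (Suc n) * s / t\<rceil>) * t / real (Suc n))) \<le> B"
          using node[of s "Suc n"] by (intro bdd) auto
        then show ?thesis using 3 step[of s "Suc n"] by simp
      qed (use \<open>t > 0\<close> bdd[of 0] in \<open>auto simp: outside zero\<close>)
    qed
  qed auto
  moreover have "(LBINT s. h n s) = (t / real n) *\<^sub>R (\<Sum>k=1..n. g (real k * t / real n))" for n
  proof -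
    have "emeasure lborel (J n k) < \<infinity>" for k
      unfolding J_def using \<open>t > 0\<close>
      by (subst emeasure_lborel_Ioc) (auto intro!: divide_right_mono mult_right_mono)
    then have i: "integrable lborel (indicator (J n k) :: real \<Rightarrow> real)" for k
      by (intro integrable_real_indicator) auto
    have m: "measure lborel (J n k) = t / real n" if "n > 0" for k
      unfolding J_def using \<open>t > 0\<close> that
      by (subst measure_lborel_Ioc) (auto simp: field_simps)
    have "(LBINT s. h n s) = (LBINT s. indicator {0::real} s *\<^sub>R g 0) +
       (LBINT s. (\<Sum>k=1..n. indicator (J n k) s *\<^sub>R g (real k * t / real n)))"
      unfolding h_def by (intro Bochner_Integration.integral_add Bochner_Integration.integrable_sum
          integrable_scaleR_left i) auto
    also have "(LBINT s. indicator {0::real} s *\<^sub>R g 0) = 0"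
      by (simp)
    also have "(LBINT s. (\<Sum>k=1..n. indicator (J n k) s *\<^sub>R g (real k * t / real n)))
      = (\<Sum>k=1..n. measure lborel (J n k) *\<^sub>R g (real k * t / real n))"
      by (subst Bochner_Integration.integral_sum) (auto simp: i)
    also have "\<dots> = (t / real n) *\<^sub>R (\<Sum>k=1..n. g (real k * t / real n))"
      unfolding scaleR_right.sum by (intro sum.cong) (auto simp: m)
    finally show ?thesis by simp
  qed
  ultimately show ?thesis
    unfolding set_lebesgue_integral_def by - (rule LIMSEQ_imp_Suc, simp only:)
qed

section \<open>The Laplace exponent of the average\<close>

text \<open>Rotating by \<open>- \<i>\<close> moves the upper half plane to the right half plane, so
  the right-hand side has its cut on the negative imaginary axis, out of the way. This shows
  continuity of the principal power up to the negative real axis.\<close>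

lemma powr_upper_half_plane:
  fixes w s :: complex
  assumes "Im w \<ge> 0"
  shows "w powr s = exp (s * (\<i> * pi / 2)) * (- \<i> * w) powr s"
proof (cases "w = 0")
  case False
  then have "Ln (\<i> * (- \<i> * w)) = Ln (- \<i> * w) + \<i> * pi / 2"
    using assms by (subst Ln_times_ii) auto
  then have "Ln w = Ln (- \<i> * w) + \<i> * pi / 2" by simp
  then show ?thesis using False by (simp add: powr_def exp_add[symmetric] algebra_simps)
qed simp

lemma continuous_on_powr_upper_half_plane:
  fixes f :: "complex \<Rightarrow> complex" and s :: complex
  assumes "continuous_on A f" "\<And>u. u \<in> A \<Longrightarrow> Im (f u) \<ge> 0" "Re s > 0"
  shows "continuous_on A (\<lambda>u. f u powr s)"
proof -
  have "continuous_on A (\<lambda>u. exp (s * (\<i> * pi / 2)) * (- \<i> * f u) powr s)"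
    using assms by (intro continuous_intros) auto
  then show ?thesis
    by (rule continuous_on_eq) (metis assms(2) powr_upper_half_plane)
qed

section \<open>The averaged exponent as a mean along a segment\<close>

locale averaged_exponent =
  fixes K b c :: real
  assumes K: "K > 0" and b: "b > 0" and c: "0 < c" "c < 1"
begin

abbreviation (input) "R \<equiv> complex_of_real"

text \<open>The case \<open>u = 0\<close> fills a removable singularity: the difference quotient
  tends to the derivative \<open>(c + 1) * b powr c\<close> there.\<close>

definition \<Psi> :: "complex \<Rightarrow> complex" where
  "\<Psi> u = (if u = 0 then 0
    else R K * (R ((c + 1) * b powr c) - ((R b + u) powr (R c + 1) - R (b powr (c + 1))) / u))"

text \<open>With \<open>K = a * t * Gamma (- c - 1)\<close> this is the Laplace exponent of
  \<open>X t\<close> itself, since then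
  \<open>a * t * Gamma (- c) = - (K * (c + 1))\<close>.\<close>

definition \<psi> :: "complex \<Rightarrow> complex" where
  "\<psi> u = - (R (K * (c + 1)) * ((R b + u) powr R c - R (b powr c)))"

lemma b_powr: "R b powr (R c + 1) = R (b powr (c + 1))"
  using b powr_of_real[of b "c + 1"] by simp

lemma \<psi>_derivative:
  assumes "Re u \<ge> 0" "u \<noteq> 0" "t > 0" "s \<ge> 0"
  shows "((\<lambda>s. - (R K * ((R b + u * R (s / t)) powr (R c + 1) / u - R ((c + 1) * b powr c) * R (s / t))))
    has_vector_derivative \<psi> (u * R (s / t)) / R t) (at s within S)"
proof -
  have np: "R b + u * R (s / t) \<notin> \<real>\<^sub>\<le>\<^sub>0"
    using assms b by (auto simp: complex_nonpos_Reals_iff Re_divide_of_real add_nonneg_eq_0_iff add_pos_nonneg not_le)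
  have "((\<lambda>z. - (R K * ((R b + u * (z / R t)) powr (R c + 1) / u - R ((c + 1) * b powr c) * (z / R t))))
      has_field_derivative \<psi> (u * R (s / t)) / R t) (at (complex_of_real s))"
    using np assms
    by (auto intro!: derivative_eq_intros DERIV_chain'[OF _ has_field_derivative_powr] simp: \<psi>_def field_simps)
  from has_vector_derivative_real_field[OF this] show ?thesis by simp
qed

lemma continuous_on_\<psi>:
  assumes "Re u \<ge> 0" "t > 0"
  shows "continuous_on {0..T} (\<lambda>s. \<psi> (u * complex_of_real (s / t)))"
  unfolding \<psi>_def using assms b c
  by (intro continuous_intros) (auto simp: add_nonneg_nonneg)

text \<open>The mean identifies the limit of the Riemann sums, and it exposes a sign of the real
  part that the closed form hides. For \<open>Re u \<ge> 0\<close> the segment from \<open>b\<close>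
  to \<open>b + u\<close> avoids the cut, so the antiderivative is valid along all of it.\<close>

lemma \<Psi>_eq_integral:
  assumes "Re u \<ge> 0" "t > 0"
  shows "(CLBINT s:{0..t}. \<psi> (u * R (s / t)) / R t) = \<Psi> u"
proof (cases "u = 0")
  case True
  then show ?thesis using b by (simp add: \<psi>_def \<Psi>_def powr_of_real)
next
  case False
  have "(CLBINT s=ereal 0..ereal t. \<psi> (u * R (s / t)) / R t) =
      - (R K * ((R b + u * R (t / t)) powr (R c + 1) / u - R ((c + 1) * b powr c) * R (t / t)))
      - (- (R K * ((R b + u * R (0 / t)) powr (R c + 1) / u - R ((c + 1) * b powr c) * R (0 / t))))"
  proof (rule interval_integral_FTC_finite)
    show "continuous_on {min 0 t..max 0 t} (\<lambda>s. \<psi> (u * R (s / t)) / R t)"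
      using assms continuous_on_\<psi>[of u t t] by (intro continuous_on_divide continuous_on_const) auto
  qed (use False assms \<psi>_derivative in auto)
  moreover have "(CLBINT s=ereal 0..ereal t. \<psi> (u * R (s / t)) / R t) = (CLBINT s:{0..t}. \<psi> (u * R (s / t)) / R t)"
    using assms by (intro interval_integral_Icc) simp
  ultimately have "(CLBINT s:{0..t}. \<psi> (u * R (s / t)) / R t) =
      - (R K * ((R b + u) powr (R c + 1) / u - R ((c + 1) * b powr c)))
      + R K * (R (b powr (c + 1)) / u)"
    using assms by (simp add: b_powr)
  also have "\<dots> = \<Psi> u"
    using False by (simp add: \<Psi>_def diff_divide_distrib algebra_simps)
  finally show ?thesis .
qed

section \<open>Decay on the imaginary axis\<close>

text \<open>The argument of \<open>w\<close> is at most \<open>pi / 2\<close> in modulus, so that of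
  the power is at most \<open>c * pi / 2\<close>, and cosine decreases on
  \<open>[0, pi]\<close>.\<close>

lemma Re_powr_ge:
  assumes "Re w \<ge> 0"
  shows "Re (w powr R c) \<ge> cos (c * pi / 2) * norm w powr c"
proof (cases "w = 0")
  case False
  have "\<bar>Im (Ln w)\<bar> \<le> pi / 2"
    using Re_Ln_pos_le[OF False] assms by simp
  then have "\<bar>c * Im (Ln w)\<bar> \<le> c * pi / 2"
    using c by (simp add: abs_mult)
  then have "cos (c * pi / 2) \<le> cos \<bar>c * Im (Ln w)\<bar>"
    using c by (intro cos_monotone_0_pi_le) (auto intro: order_trans[of _ pi])
  then show ?thesis
    using False by (simp add: powr_def Re_exp mult.commute mult_right_mono)
qed simp

lemma norm_exp_\<Psi>_imaginary:
  "norm (exp (\<Psi> (\<i> * R \<theta>))) \<le>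
    exp (K * (c + 1) * b powr c - K * (c + 1) * cos (c * pi / 2) / 2 * \<bar>\<theta>\<bar> powr c)"
proof -
  let ?A = "K * (c + 1) * b powr c" and ?B = "K * (c + 1) * cos (c * pi / 2) * \<bar>\<theta>\<bar> powr c"
  let ?g = "\<lambda>s. \<psi> (\<i> * R \<theta> * complex_of_real (s / 1)) / complex_of_real 1"
  have cos: "cos (c * pi / 2) \<ge> 0"
    using c by (intro cos_ge_zero) (auto intro: order_trans[of _ 0])
  have int: "set_integrable lborel {0..1} ?g"
    using continuous_on_\<psi>[of "\<i> * R \<theta>" 1 1] by (intro borel_integrable_atLeastAtMost') auto
  have eq: "\<Psi> (\<i> * R \<theta>) = (CLBINT s:{0..1}. ?g s)"
    by (subst \<Psi>_eq_integral) auto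
  have "Re (\<Psi> (\<i> * R \<theta>)) = (LBINT s:{0..1}. Re (?g s))"
    unfolding eq set_lebesgue_integral_def using int unfolding set_integrable_def
    by (subst integral_Re[symmetric]) auto
  also have "\<dots> \<le> (LBINT s:{0..1}. ?A - ?B * s)"
  proof (rule set_integral_mono)
    show "set_integrable lborel {0..1} (\<lambda>s. Re (?g s))"
      using int unfolding set_integrable_def by (drule_tac integrable_Re) simp
    show "set_integrable lborel {0..1} (\<lambda>s. ?A - ?B * s)"
      by (intro borel_integrable_atLeastAtMost' continuous_intros)
    fix s :: real assume s: "s \<in> {0..1}"
    let ?w = "R b + \<i> * R \<theta> * R s"
    have "\<bar>\<theta>\<bar> * s \<le> norm ?w"
      using abs_Im_le_cmod[of ?w] s by (simp add: abs_mult)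
    then have "(\<bar>\<theta>\<bar> * s) powr c \<le> norm ?w powr c"
      using s c by (intro powr_mono2) auto
    \<comment> \<open>Replacing \<open>s powr c\<close> by \<open>s\<close> on the unit interval
      makes the integrand affine; integrating it produces the factor \<open>1 / 2\<close> in the
      bound.\<close>
    moreover have "s \<le> s powr c"
      using powr_mono'[of c 1 s] s c by (cases "s = 0") auto
    ultimately have "\<bar>\<theta>\<bar> powr c * s \<le> norm ?w powr c"
      using s by (smt (verit) powr_mult abs_ge_zero mult_left_mono powr_ge_zero atLeastAtMost_iff)
    then have "cos (c * pi / 2) * (\<bar>\<theta>\<bar> powr c * s) \<le> Re (?w powr R c)"
      using Re_powr_ge[of ?w] b cos by (smt (verit) mult_left_mono Re_complex_of_real plus_complex.sel mult_eq_0_iff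
         complex_Re_of_int times_complex.sel imaginary_unit.sel Im_complex_of_real)
    then have "K * (c + 1) * (cos (c * pi / 2) * (\<bar>\<theta>\<bar> powr c * s)) \<le> K * (c + 1) * Re (?w powr R c)"
      using K c by (intro mult_left_mono) auto
    moreover have "Re (?g s) = K * (c + 1) * b powr c - K * (c + 1) * Re (?w powr R c)"
      using b by (simp add: \<psi>_def powr_of_real right_diff_distrib)
    ultimately show "Re (?g s) \<le> ?A - ?B * s" by (simp add: mult_ac)
  qed
  also have "(LBINT s:{0..1}. ?A - ?B * s) = ?A - ?B / 2"
  proof -
    have "(LBINT s=0..1. ?A - ?B * s) = (?A * 1 - ?B * 1\<^sup>2 / 2) - (?A * 0 - ?B * 0\<^sup>2 / 2)"
      unfolding zero_ereal_def one_ereal_def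
    proof (rule interval_integral_FTC_finite)
      show "continuous_on {min 0 1..max 0 1} (\<lambda>s. ?A - ?B * s)"
        by (intro continuous_intros)
      show "((\<lambda>s. ?A * s - ?B * s\<^sup>2 / 2) has_vector_derivative ?A - ?B * s)
          (at s within {min 0 1..max 0 1})" for s
        unfolding has_real_derivative_iff_has_vector_derivative[symmetric]
        by (auto intro!: derivative_eq_intros)
    qed
    then show ?thesis by (simp add: interval_integral_Icc zero_ereal_def one_ereal_def)
  qed
  finally show ?thesis by (simp add: norm_exp_eq_Re)
qed

section \<open>Boundary continuity, derivative and growth in the upper half plane\<close>

text \<open>The contour touches the real axis, so continuity is needed at 0, at \<open>- b\<close>
  and along the cut. At 0 it is differentiability of the power; elsewhere it is continuity of powers
  from above.\<close>

lemma continuous_on_\<Psi>: "continuous_on {u. Im u \<ge> 0} \<Psi>"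
proof -
  let ?H = "{u. Im u \<ge> 0}"
  let ?q = "\<lambda>u. ((R b + u) powr (R c + 1) - R (b powr (c + 1))) / u"
  have "(\<Psi> \<longlongrightarrow> \<Psi> u) (at u within ?H)" if u: "u \<in> ?H" for u
  proof (cases "u = 0")
    case True
    have "((\<lambda>u. (R b + u) powr (R c + 1)) has_field_derivative R ((c + 1) * b powr c)) (at 0)"
      using b by (auto intro!: derivative_eq_intros DERIV_chain'[OF _ has_field_derivative_powr]
          simp: powr_of_real complex_nonpos_Reals_iff)
    then have "(?q \<longlongrightarrow> R ((c + 1) * b powr c)) (at 0)"
      using b by (simp add: DERIV_def b_powr)
    then have "((\<lambda>u. R K * (R ((c + 1) * b powr c) - ?q u)) \<longlongrightarrow> R K * (R ((c + 1) * b powr c) - R ((c + 1) * b powr c))) (at 0)"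
      by (intro tendsto_intros)
    then have "((\<lambda>u. R K * (R ((c + 1) * b powr c) - ?q u)) \<longlongrightarrow> 0) (at 0 within ?H)"
      by (auto intro: tendsto_within_subset)
    then have "(\<Psi> \<longlongrightarrow> 0) (at 0 within ?H)"
      by (rule Lim_transform_eventually) (auto simp: eventually_at_filter \<Psi>_def)
    then show ?thesis using True by (simp add: \<Psi>_def)
  next
    case False
    have "continuous_on (?H - {0}) (\<lambda>u. R K * (R ((c + 1) * b powr c) - ?q u))"
      using c by (intro continuous_intros continuous_on_powr_upper_half_plane) auto
    then have "continuous_on (?H - {0}) \<Psi>"
      by (rule continuous_on_eq) (simp add: \<Psi>_def)
    then have "(\<Psi> \<longlongrightarrow> \<Psi> u) (at u within (?H - {0}))"
      using u False by (auto simp: continuous_on_def)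
    moreover have "at u within (?H - {0}) = at u within ?H"
      using False by (intro at_within_nhd[of u "- {0}"]) auto
    ultimately show ?thesis by simp
  qed
  then show ?thesis unfolding continuous_on_def by blast
qed

definition \<Psi>' :: "complex \<Rightarrow> complex" where
  "\<Psi>' u = - (R K * ((R c + 1) * (R b + u) powr R c / u - ((R b + u) powr (R c + 1) - R (b powr (c + 1))) / u\<^sup>2))"

lemma \<Psi>_has_derivative:
  assumes "Im u > 0"
  shows "(\<Psi> has_field_derivative \<Psi>' u) (at u)"
proof -
  have np: "R b + u \<notin> \<real>\<^sub>\<le>\<^sub>0" "u \<noteq> 0"
    using assms by (auto simp: complex_nonpos_Reals_iff)
  have "((\<lambda>u. R K * (R ((c + 1) * b powr c) - ((R b + u) powr (R c + 1) - R (b powr (c + 1))) / u))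
      has_field_derivative \<Psi>' u) (at u)"
    unfolding \<Psi>'_def using np 
    by (auto intro!: derivative_eq_intros DERIV_chain'[OF _ has_field_derivative_powr]
       simp: field_simps power2_eq_square)
  then show ?thesis
  proof (rule has_field_derivative_transform_within_open[where S="- {0}"])
  qed (use np in \<open>auto simp: \<Psi>_def\<close>)
qed

lemma norm_powr_shift_le:
  assumes "norm u \<ge> b" "p \<ge> 0"
  shows "norm ((R b + u) powr R p) \<le> 2 powr p * norm u powr p"
proof -
  have "norm (R b + u) \<le> 2 * norm u"
    using norm_triangle_ineq[of "complex_of_real b" u] assms b by simp
  then have "norm (R b + u) powr p \<le> (2 * norm u) powr p"
    using assms by (intro powr_mono2) auto
  then show ?thesis by (simp add: norm_powr_real_powr' powr_mult)
qed

text \<open>The constant is \<open>4 + 1\<close>: the shifted power costs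
  \<open>2 powr (c + 1) \<le> 4\<close>, and the constant term is at most
  \<open>norm u powr (c + 1)\<close> because \<open>b \<le> norm u\<close>.\<close>

lemma norm_difference_quotient_le:
  assumes "norm u \<ge> b"
  shows "norm (((R b + u) powr (R c + 1) - R (b powr (c + 1))) / u) \<le> 5 * norm u powr c"
proof -
  have u: "norm u > 0" using assms b by linarith
  have "norm ((R b + u) powr (R c + 1) - R (b powr (c + 1))) \<le>
      norm ((R b + u) powr (R c + 1)) + norm (complex_of_real (b powr (c + 1)))"
    by (rule norm_triangle_ineq4)
  also have "\<dots> \<le> 2 powr (c + 1) * norm u powr (c + 1) + norm u powr (c + 1)"
    using norm_powr_shift_le[of u "c + 1"] assms c b by (intro add_mono) (auto intro!: powr_mono2)
  also have "2 powr (c + 1) * norm u powr (c + 1) \<le> 4 * norm u powr (c + 1)"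
    using c powr_mono[of "c + 1" 2 2] by (intro mult_right_mono) auto
  finally show ?thesis
    using u by (simp add: norm_divide powr_add field_simps)
qed

lemma norm_\<Psi>_le:
  assumes "norm u \<ge> b"
  shows "norm (\<Psi> u) \<le> K * (c + 1) * b powr c + 5 * K * norm u powr c"
proof -
  have u: "u \<noteq> 0" using assms b by auto
  have "norm (R ((c + 1) * b powr c) - ((R b + u) powr (R c + 1) - R (b powr (c + 1))) / u) \<le>
      norm (complex_of_real ((c + 1) * b powr c)) + 5 * norm u powr c"
    by (rule order_trans[OF norm_triangle_ineq4 add_left_mono[OF norm_difference_quotient_le[OF assms]]])
  also have "\<dots> = (c + 1) * b powr c + 5 * norm u powr c"
    using c by (simp only: norm_of_real) simp
  finally have "K * norm (R ((c + 1) * b powr c) - ((R b + u) powr (R c + 1) - R (b powr (c + 1))) / u)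
      \<le> K * ((c + 1) * b powr c + 5 * norm u powr c)"
    using K by (intro mult_left_mono) auto
  moreover have "norm (\<Psi> u) =
      K * norm (R ((c + 1) * b powr c) - ((R b + u) powr (R c + 1) - R (b powr (c + 1))) / u)"
    using u K by (simp only: \<Psi>_def if_False norm_mult norm_of_real abs_of_pos)
  ultimately have "norm (\<Psi> u) \<le> K * ((c + 1) * b powr c + 5 * norm u powr c)"
    by (simp only:)
  then show ?thesis by (simp add: algebra_simps)
qed

text \<open>The constant is \<open>4 + 5\<close>, with 4 from \<open>c + 1 \<le> 2\<close> and
  \<open>2 powr c \<le> 2\<close>. What matters is the negative exponent \<open>c - 1\<close>: the
  derivative tends to 0 at infinity.\<close>

lemma norm_\<Psi>'_le:
  assumes "norm u \<ge> b"
  shows "norm (\<Psi>' u) \<le> 9 * K * norm u powr (c - 1)"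
proof -
  have u: "norm u > 0" using assms b by linarith
  have "norm ((R c + 1) * (R b + u) powr R c / u) \<le> 4 * norm u powr (c - 1)"
  proof -
    have "norm ((R b + u) powr R c) \<le> 2 powr c * norm u powr c"
      using norm_powr_shift_le[of u c] assms c by simp
    also have "\<dots> \<le> 2 * norm u powr c"
      using c powr_mono[of c 1 2] by (intro mult_right_mono) auto
    finally have "(c + 1) * norm ((R b + u) powr R c) \<le> 2 * (2 * norm u powr c)"
      using c by (intro mult_mono) auto
    then have "(c + 1) * norm ((R b + u) powr R c) / norm u \<le> 2 * (2 * norm u powr c) / norm u"
      using u by (intro divide_right_mono) auto
    moreover have "norm (R c + 1) = c + 1"
      using c norm_of_real[of "c + 1", where ?'a=complex] by simp
    ultimately show ?thesis
      using u by (simp only: norm_divide norm_mult) (simp add: powr_diff)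
  qed
  moreover have "norm (((R b + u) powr (R c + 1) - R (b powr (c + 1))) / u\<^sup>2) \<le> 5 * norm u powr (c - 1)"
  proof -
    have "norm (((R b + u) powr (R c + 1) - R (b powr (c + 1))) / u) / norm u \<le> 5 * norm u powr c / norm u"
      using norm_difference_quotient_le[OF assms] by (intro divide_right_mono) auto
    then show ?thesis using u by (simp add: norm_divide norm_mult power2_eq_square powr_diff)
  qed
  ultimately have "norm ((R c + 1) * (R b + u) powr R c / u - ((R b + u) powr (R c + 1) - R (b powr (c + 1))) / u\<^sup>2)
      \<le> 9 * norm u powr (c - 1)"
    by (intro order_trans[OF norm_triangle_ineq4]) linarith
  then have "K * norm ((R c + 1) * (R b + u) powr R c / u - ((R b + u) powr (R c + 1) - R (b powr (c + 1))) / u\<^sup>2)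
      \<le> K * (9 * norm u powr (c - 1))"
    using K by (intro mult_left_mono) auto
  then show ?thesis
    using K by (simp only: \<Psi>'_def norm_mult norm_minus_cancel norm_of_real abs_of_pos mult_ac)
qed

end

section \<open>Rotation of the inversion contour\<close>

text \<open>Continuity takes care of a compact part and the bound of the tails, so the later
  integrability claims reduce to estimates for large arguments.\<close>

lemma set_integrable_quadratic_decay:
  fixes f :: "real \<Rightarrow> 'a :: euclidean_space"
  assumes "closed S" "continuous_on S f"
    and "\<And>s. s \<in> S \<Longrightarrow> \<bar>s\<bar> \<ge> N \<Longrightarrow> norm (f s) \<le> 1 / (1 + s\<^sup>2)"
  shows "set_integrable lborel S f"
proof -
  have "compact (S \<inter> {-N..N})"
    using assms(1) by (intro closed_Int_compact) auto
  then have "bounded (f ` (S \<inter> {-N..N}))"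
    by (intro compact_imp_bounded compact_continuous_image continuous_on_subset[OF assms(2)]) auto
  then obtain B where B: "\<And>s. s \<in> S \<inter> {-N..N} \<Longrightarrow> norm (f s) \<le> B"
    unfolding bounded_iff by blast
  have "integrable lborel (\<lambda>s. \<bar>B\<bar> * indicator {-N..N} s + inverse (1 + s\<^sup>2))"
    using integrable_inverse_1_plus_square
    by (intro Bochner_Integration.integrable_add integrable_mult_right integrable_real_indicator)
       (auto simp: set_integrable_def emeasure_lborel_Icc_eq)
  then show ?thesis
    unfolding set_integrable_def
  proof (rule Bochner_Integration.integrable_bound)
    show "(\<lambda>s. indicator S s *\<^sub>R f s) \<in> borel_measurable lborel"
      using assms borel_measurable_continuous_on_indicator[of S f] by simp
    have "norm (f s) \<le> \<bar>B\<bar> * indicator {-N..N} s + inverse (1 + s\<^sup>2)" if "s \<in> S" for s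
    proof (cases "\<bar>s\<bar> \<ge> N")
      case True
      then have "norm (f s) \<le> inverse (1 + s\<^sup>2)"
        using assms(3)[of s] that by (simp add: field_simps)
      then show ?thesis by (auto intro: add_increasing)
    next
      case False
      then have "s \<in> S \<inter> {-N..N}" using that by auto
      from B[OF this] have "norm (f s) \<le> \<bar>B\<bar>" by linarith
      moreover have "indicat_real {-N..N} s = 1" using False by (auto simp: indicator_def)
      ultimately show ?thesis by (auto intro: add_increasing2)
    qed
    then show "AE s in lborel. norm (indicator S s *\<^sub>R f s) \<le>
        norm (\<bar>B\<bar> * indicator {-N..N} s + inverse (1 + s\<^sup>2))"
      by (intro AE_I2) (auto simp: indicator_def abs_le_iff intro: order_trans[OF _ abs_ge_self])
  qed
qed

lemma integral_even:
  fixes f :: "real \<Rightarrow> real"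
  assumes "integrable lborel f" "\<And>s. f (- s) = f s"
  shows "(LBINT s. f s) = 2 * (LBINT s:{0..}. f s)"
proof -
  have si: "set_integrable lborel A f" if "A \<in> sets borel" for A
    using assms(1) that unfolding set_integrable_def by (intro integrable_mult_indicator) auto
  have [measurable]: "f \<in> borel_measurable borel"
    using borel_measurable_integrable[OF assms(1)] by simp
  have "(LBINT s. f s) = (LBINT s. indicator {0..} s *\<^sub>R f s + indicator {..0} s *\<^sub>R f s)"
  proof (rule integral_cong_AE)
    show "AE s in lborel. f s = indicator {0..} s *\<^sub>R f s + indicator {..0} s *\<^sub>R f s"
      using AE_lborel_singleton[of 0] by eventually_elim (auto simp: indicator_def)
  qed measurable
  also have "\<dots> = (LBINT s:{0..}. f s) + (LBINT s:{..0}. f s)"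
    unfolding set_lebesgue_integral_def using si[of "{0..}"] si[of "{..0}"]
    by (intro Bochner_Integration.integral_add) (auto simp: set_integrable_def)
  also have "(LBINT s:{..0}. f s) = (LBINT s:{0..}. f s)"
    by (subst set_integral_reflect) (simp add: assms(2) atLeast_def)
  finally show ?thesis by simp
qed

context averaged_exponent
begin

section \<open>Cauchy's theorem on a square and bounds for its edges\<close>

text \<open>The integrand of the inverse Laplace (Bromwich) integral for a variable with transform
  \<open>exp (\<Psi> u)\<close>.\<close>

definition G :: "real \<Rightarrow> complex \<Rightarrow> complex" where
  "G x u = exp (u * R x + \<Psi> u)"

lemma continuous_on_G: "continuous_on {u. Im u \<ge> 0} (G x)"
  unfolding G_def by (intro continuous_intros continuous_on_\<Psi>)

lemma rectangle_contour_integral: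
  assumes "T > 0"
  shows "contour_integral (linepath 0 (\<i> * R T)) (G x) +
    (contour_integral (linepath (\<i> * R T) (- R T + \<i> * R T)) (G x) +
    (contour_integral (linepath (- R T + \<i> * R T) (- R T)) (G x) +
     contour_integral (linepath (- R T) 0) (G x))) = 0"
proof -
  let ?H = "{u. Im u \<ge> 0}"
  let ?g = "linepath 0 (\<i> * R T) +++ linepath (\<i> * R T) (- R T + \<i> * R T) +++
      linepath (- R T + \<i> * R T) (- R T) +++ linepath (- R T) 0"
  have seg: "closed_segment u v \<subseteq> ?H" if "u \<in> ?H" "v \<in> ?H" for u v
    using that convex_halfspace_Im_ge[of 0] by (rule closed_segment_subset)
  have H: "0 \<in> ?H" "\<i> * R T \<in> ?H" "- R T + \<i> * R T \<in> ?H" "- R T \<in> ?H"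
    using assms by auto
  \<comment> \<open>This form of Cauchy's theorem asks for continuity on the closed half plane and
    holomorphy only inside, which permits the bottom edge to run along the cut.\<close>
  have "((G x) has_contour_integral 0) ?g"
  proof (rule Cauchy_theorem_convex[OF continuous_on_G convex_halfspace_Im_ge finite.emptyI])
    fix u assume "u \<in> interior ?H - {}"
    then obtain e where e: "e > 0" "ball u e \<subseteq> ?H"
      by (auto simp: mem_interior)
    \<comment> \<open>Moving straight down inside the ball shows that an interior point has strictly
      positive imaginary part.\<close>
    have "u - \<i> * R (e / 2) \<in> ball u e"
      using e by (simp add: dist_norm norm_mult)
    then have "u - \<i> * R (e / 2) \<in> ?H" using e by blast
    then have "Im u > 0" using e by simp
    then have "(\<Psi> has_field_derivative \<Psi>' u) (at u)"
      by (rule \<Psi>_has_derivative)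
    then show "G x field_differentiable at u"
      unfolding G_def field_differentiable_def by (auto intro!: exI derivative_eq_intros)
  next
    show "path_image ?g \<subseteq> ?H"
      by (intro subset_path_image_join; simp only: path_image_linepath; intro seg H)
  qed (auto intro!: valid_path_join)
  then have "contour_integral ?g (G x) = 0"
    by (rule contour_integral_unique)
  moreover have "G x contour_integrable_on linepath u v" if "u \<in> ?H" "v \<in> ?H" for u v
    using seg[OF that] by (intro contour_integrable_continuous_linepath continuous_on_subset[OF continuous_on_G])
  ultimately show ?thesis using H
    by (simp add: contour_integral_join contour_integrable_joinI valid_path_join)
qed

lemma norm_G: "norm (G x u) = exp (Re u * x + Re (\<Psi> u))"
  by (simp add: G_def norm_exp_eq_Re)

text \<open>
  Decay of \<open>\<Psi>'\<close> makes \<open>Re \<Psi>\<close> grow along the edge at rate at most \<open>x\<close>, which the factor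
  \<open>exp (u x)\<close> compensates; so the left end of the edge needs no separate estimate even when
  \<open>exp \<Psi>\<close> grows near the negative axis.
\<close>

lemma top_edge_bound:
  assumes "T \<ge> b" "9 * K * T powr (c - 1) \<le> x"
  shows "norm (contour_integral (linepath (\<i> * R T) (- R T + \<i> * R T)) (G x))
    \<le> T * norm (exp (\<Psi> (\<i> * R T)))"
proof -
  have T: "T > 0" using assms b by simp
  have "norm (contour_integral (linepath (\<i> * R T) (- R T + \<i> * R T)) (G x)) \<le>
      norm (exp (\<Psi> (\<i> * R T))) * norm (- R T + \<i> * R T - \<i> * R T)"
  proof (rule contour_integral_bound_linepath)
    show "G x contour_integrable_on linepath (\<i> * R T) (- R T + \<i> * R T)"
      using T by (intro contour_integrable_continuous_linepath continuous_on_subset[OF continuous_on_G])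
        (auto simp: closed_segment_same_Im)
    fix u assume u: "u \<in> closed_segment (\<i> * R T) (- R T + \<i> * R T)"
    then have Im: "Im u = T" and Re: "Re u \<le> 0"
      using T by (auto simp: closed_segment_same_Im closed_segment_eq_real_ivl)
    have "norm (\<Psi> u - \<Psi> (\<i> * R T)) \<le> x * norm (u - \<i> * R T)"
    proof (rule field_differentiable_bound[of "{u. Im u \<ge> T}"])
      show "convex {u. T \<le> Im u}" by (rule convex_halfspace_Im_ge)
      fix z assume z: "z \<in> {u. T \<le> Im u}"
      then show "(\<Psi> has_field_derivative \<Psi>' z) (at z within {u. T \<le> Im u})"
        using T by (intro has_field_derivative_at_within[OF \<Psi>_has_derivative]) auto
      have Tz: "T \<le> norm z" using z abs_Im_le_cmod[of z] by simp
      have "norm (\<Psi>' z) \<le> 9 * K * norm z powr (c - 1)"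
        using Tz assms by (intro norm_\<Psi>'_le) simp
      also have "\<dots> \<le> 9 * K * T powr (c - 1)"
        using Tz T c K by (intro mult_left_mono powr_mono2') auto
      finally show "norm (\<Psi>' z) \<le> x" using assms by simp
    qed (use Im in auto)
    moreover have "norm (u - \<i> * R T) = - Re u"
      using Im Re by (simp add: cmod_def)
    ultimately have "Re (\<Psi> u) - Re (\<Psi> (\<i> * R T)) \<le> x * (- Re u)"
      using complex_Re_le_cmod[of "\<Psi> u - \<Psi> (\<i> * R T)"] by simp
    then show "norm (G x u) \<le> norm (exp (\<Psi> (\<i> * R T)))"
      by (simp add: norm_G norm_exp_eq_Re algebra_simps)
  qed simp
  then show ?thesis using T by (simp add: mult.commute)
qed

text \<open>On this edge \<open>norm u\<close> lies between \<open>T\<close> and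
  \<open>2 * T\<close>, so the exponent grows at most like \<open>T powr c\<close> while
  \<open>exp (u * x)\<close> contributes \<open>exp (- x * T)\<close>. The bound vanishes in the
  limit because \<open>c < 1\<close> and \<open>x > 0\<close>.\<close>

lemma left_edge_bound:
  assumes "T \<ge> b"
  shows "norm (contour_integral (linepath (- R T + \<i> * R T) (- R T)) (G x))
    \<le> T * exp (- x * T + (K * (c + 1) * b powr c + 5 * K * (2 * T) powr c))"
proof -
  have T: "T > 0" using assms b by simp
  have "norm (contour_integral (linepath (- R T + \<i> * R T) (- R T)) (G x)) \<le>
      exp (- x * T + (K * (c + 1) * b powr c + 5 * K * (2 * T) powr c)) * norm (- R T - (- R T + \<i> * R T))"
  proof (rule contour_integral_bound_linepath)
    show "G x contour_integrable_on linepath (- R T + \<i> * R T) (- R T)"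
      using T by (intro contour_integrable_continuous_linepath continuous_on_subset[OF continuous_on_G])
        (auto simp: closed_segment_same_Re closed_segment_eq_real_ivl)
    fix u assume u: "u \<in> closed_segment (- R T + \<i> * R T) (- R T)"
    then have Re: "Re u = - T" and Im: "0 \<le> Im u" "Im u \<le> T"
      using T by (auto simp: closed_segment_same_Re closed_segment_eq_real_ivl)
    have "b \<le> norm u" using abs_Re_le_cmod[of u] Re assms by simp
    then have "norm (\<Psi> u) \<le> K * (c + 1) * b powr c + 5 * K * norm u powr c"
      by (rule norm_\<Psi>_le)
    also have "\<dots> \<le> K * (c + 1) * b powr c + 5 * K * (2 * T) powr c"
      using cmod_le[of u] Re Im T K c by (intro add_left_mono mult_left_mono powr_mono2) auto
    finally have "Re (\<Psi> u) \<le> K * (c + 1) * b powr c + 5 * K * (2 * T) powr c"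
      using complex_Re_le_cmod[of "\<Psi> u"] by simp
    then show "norm (G x u) \<le> exp (- x * T + (K * (c + 1) * b powr c + 5 * K * (2 * T) powr c))"
      using Re by (simp add: norm_G mult.commute)
  qed simp
  then show ?thesis using T by (simp add: mult.commute norm_mult)
qed

section \<open>The limit of large squares\<close>

lemma cos_pos: "cos (c * pi / 2) > 0"
  using c by (intro cos_gt_zero) auto

lemma ex_decay_bound:
  assumes "B > 0"
  shows "\<exists>N. \<forall>s\<ge>N. exp (A - B * s powr c) \<le> 1 / (1 + s\<^sup>2)"
proof -
  have "\<forall>\<^sub>F s in at_top. exp (A - B * s powr c) \<le> 1 / (1 + s\<^sup>2)"
    using assms c by real_asymp
  then show ?thesis by (simp add: eventually_at_top_linorder)
qed

lemma decay_limit: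
  assumes "B > 0"
  shows "((\<lambda>T. T * exp (A - B * T powr c)) \<longlongrightarrow> 0) at_top"
  using assms c by real_asymp

lemma integrable_imaginary_bound:
  assumes "B > 0"
  shows "integrable lborel (\<lambda>s. exp (A - B * \<bar>s\<bar> powr c))"
proof -
  obtain N where N: "\<And>s. s \<ge> N \<Longrightarrow> exp (A - B * s powr c) \<le> 1 / (1 + s\<^sup>2)"
    using ex_decay_bound[OF assms] by blast
  have "set_integrable lborel UNIV (\<lambda>s. exp (A - B * \<bar>s\<bar> powr c))"
  proof (rule set_integrable_quadratic_decay[where N=N])
    show "norm (exp (A - B * \<bar>s\<bar> powr c)) \<le> 1 / (1 + s\<^sup>2)" if "N \<le> \<bar>s\<bar>" for s
      using N[OF that] by simp
    show "continuous_on UNIV (\<lambda>s. exp (A - B * \<bar>s\<bar> powr c))"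
      using c by (intro continuous_on_exp continuous_on_diff continuous_on_mult continuous_on_const
          continuous_on_powr' continuous_on_rabs continuous_on_id) auto
  qed simp
  then show ?thesis by (simp add: set_integrable_def)
qed

lemma set_integrable_G_imaginary: "set_integrable lborel {0..} (\<lambda>s. G x (\<i> * R s))"
proof -
  let ?A = "K * (c + 1) * b powr c" and ?B = "K * (c + 1) * cos (c * pi / 2) / 2"
  have "?B > 0" using K c cos_pos by simp
  then obtain N where N: "\<And>s. s \<ge> N \<Longrightarrow> exp (?A - ?B * s powr c) \<le> 1 / (1 + s\<^sup>2)"
    using ex_decay_bound by blast
  show ?thesis
  proof (rule set_integrable_quadratic_decay[where N=N])
    show "continuous_on {0..} (\<lambda>s. G x (\<i> * R s))"
      by (intro continuous_on_compose2[OF continuous_on_G] continuous_intros) auto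
    show "norm (G x (\<i> * R s)) \<le> 1 / (1 + s\<^sup>2)" if "s \<in> {0..}" "N \<le> \<bar>s\<bar>" for s
    proof -
      have "norm (G x (\<i> * R s)) \<le> exp (?A - ?B * \<bar>s\<bar> powr c)"
        using norm_exp_\<Psi>_imaginary[of s] by (simp only: norm_G norm_exp_eq_Re) simp
      also have "\<dots> \<le> 1 / (1 + s\<^sup>2)"
        using N[of s] that by simp
      finally show ?thesis .
    qed
  qed simp
qed

lemma set_integrable_G_negative:
  assumes "x > 0"
  shows "set_integrable lborel {0..} (\<lambda>r. G x (- R r))"
proof -
  let ?A = "K * (c + 1) * b powr c"
  have "\<forall>\<^sub>F r in at_top. exp (- x * r + (?A + 5 * K * r powr c)) \<le> 1 / (1 + r\<^sup>2)"
    using assms K c by real_asymp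
  then obtain N where N: "\<And>r. r \<ge> N \<Longrightarrow> exp (- x * r + (?A + 5 * K * r powr c)) \<le> 1 / (1 + r\<^sup>2)"
    by (auto simp: eventually_at_top_linorder)
  show ?thesis
  proof (rule set_integrable_quadratic_decay[where N="max N b"])
    show "continuous_on {0..} (\<lambda>r. G x (- R r))"
      by (intro continuous_on_compose2[OF continuous_on_G] continuous_intros) auto
    fix r :: real assume r: "r \<in> {0..}" "max N b \<le> \<bar>r\<bar>"
    have "norm (\<Psi> (- R r)) \<le> ?A + 5 * K * r powr c"
      using norm_\<Psi>_le[of "- R r"] r by simp
    then have "Re (\<Psi> (- R r)) \<le> ?A + 5 * K * r powr c"
      using complex_Re_le_cmod[of "\<Psi> (- R r)"] by simp
    then have "norm (G x (- R r)) \<le> exp (- x * r + (?A + 5 * K * r powr c))"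
      by (simp add: norm_G mult.commute)
    then show "norm (G x (- R r)) \<le> 1 / (1 + r\<^sup>2)"
      using N[of r] r by simp
  qed simp
qed

lemma imaginary_eq_negative_axis:
  assumes "x > 0"
  shows "Re (CLBINT s:{0..}. G x (\<i> * R s)) = - Im (CLBINT r:{0..}. G x (- R r))"
proof -
  let ?A = "K * (c + 1) * b powr c" and ?B = "K * (c + 1) * cos (c * pi / 2) / 2"
  let ?I = "\<lambda>T. CLBINT s:{0..T}. G x (\<i> * R s)" and ?J = "\<lambda>T. CLBINT r:{0..T}. G x (- R r)"
  let ?top = "\<lambda>T. contour_integral (linepath (\<i> * R T) (- R T + \<i> * R T)) (G x)"
  let ?left = "\<lambda>T. contour_integral (linepath (- R T + \<i> * R T) (- R T)) (G x)"
  have B: "?B > 0" using K c cos_pos by simp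
  have eq: "\<i> * ?I T + ?J T = - (?top T + ?left T)" if "T > 0" for T
  proof -
    have si: "set_integrable lborel {0..T} (\<lambda>s. G x (\<i> * R s))"
      using set_integrable_G_imaginary by (rule set_integrable_subset) auto
    have sj: "set_integrable lborel {0..T} (\<lambda>s. G x (- R s))"
      using set_integrable_G_negative[OF assms] by (rule set_integrable_subset) auto
    have sj': "set_integrable lborel {-T..0} (\<lambda>s. G x (R s))"
      by (intro borel_integrable_atLeastAtMost' continuous_on_compose2[OF continuous_on_G] continuous_intros) auto
    have "contour_integral (linepath 0 (\<i> * R T)) (G x) = \<i> * integral {0..T} (\<lambda>s. G x (Complex 0 s))"
      using that by (intro contour_integral_linepath_same_Re) auto
    also have "(\<lambda>s. G x (Complex 0 s)) = (\<lambda>s. G x (\<i> * R s))"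
      by (simp add: Complex_eq)
    also have "integral {0..T} (\<lambda>s. G x (\<i> * R s)) = ?I T"
      using set_borel_integral_eq_integral(2)[OF si] by simp
    finally have 1: "contour_integral (linepath 0 (\<i> * R T)) (G x) = \<i> * ?I T" .
    have "contour_integral (linepath (- R T) 0) (G x) = integral {-T..0} (\<lambda>s. G x (R s))"
      using that contour_integral_linepath_Reals_eq[of "- R T" 0 "G x"] by simp
    also have "\<dots> = (CLBINT s:{-T..0}. G x (R s))"
      using set_borel_integral_eq_integral(2)[OF sj'] by simp
    also have "\<dots> = (CLBINT s:{s. - s \<in> {-T..0}}. G x (- R s))"
      by (subst set_integral_reflect) simp
    also have "{s. - s \<in> {-T..0}} = {0..T}" by auto
    finally have 2: "contour_integral (linepath (- R T) 0) (G x) = ?J T" .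
    have "p + s = - (q + r)" if "p + (q + (r + s)) = 0" for p q r s :: complex
      using that by algebra
    then show ?thesis using rectangle_contour_integral[OF that, of x] unfolding 1 2 by blast
  qed
  have "((\<lambda>T. ?top T) \<longlongrightarrow> 0) at_top"
  proof (rule Lim_null_comparison)
    \<comment> \<open>The hypothesis of \<open>top_edge_bound\<close> holds for large
      \<open>T\<close> because \<open>c - 1 < 0\<close> and \<open>x > 0\<close>.\<close>
    have "\<forall>\<^sub>F T in at_top. 9 * K * T powr (c - 1) \<le> x"
      using assms K c by real_asymp
    then show "\<forall>\<^sub>F T in at_top. norm (?top T) \<le> T * exp (?A - ?B * T powr c)"
      using eventually_ge_at_top[of b]
    proof eventually_elim
      case (elim T)
      have "norm (?top T) \<le> T * norm (exp (\<Psi> (\<i> * R T)))"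
        using elim by (intro top_edge_bound)
      also have "\<dots> \<le> T * exp (?A - ?B * \<bar>T\<bar> powr c)"
        using elim b by (intro mult_left_mono norm_exp_\<Psi>_imaginary) auto
      finally show ?case using elim b by simp
    qed
    show "((\<lambda>T. T * exp (?A - ?B * T powr c)) \<longlongrightarrow> 0) at_top"
      by (rule decay_limit[OF B])
  qed
  moreover have "((\<lambda>T. ?left T) \<longlongrightarrow> 0) at_top"
  proof (rule Lim_null_comparison)
    show "\<forall>\<^sub>F T in at_top. norm (?left T) \<le> T * exp (- x * T + (?A + 5 * K * (2 * T) powr c))"
      using eventually_ge_at_top[of b] by eventually_elim (rule left_edge_bound)
    show "((\<lambda>T. T * exp (- x * T + (?A + 5 * K * (2 * T) powr c))) \<longlongrightarrow> 0) at_top"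
      using assms K c by real_asymp
  qed
  ultimately have "((\<lambda>T. - (?top T + ?left T)) \<longlongrightarrow> - (0 + 0)) at_top"
    by (intro tendsto_intros)
  moreover have "\<forall>\<^sub>F T in at_top. - (?top T + ?left T) = \<i> * ?I T + ?J T"
    using eventually_gt_at_top[of 0] by eventually_elim (simp add: eq)
  ultimately have "((\<lambda>T. \<i> * ?I T + ?J T) \<longlongrightarrow> - (0 + 0)) at_top"
    by (rule Lim_transform_eventually)
  moreover have "((\<lambda>T. \<i> * ?I T + ?J T) \<longlongrightarrow>
      \<i> * (CLBINT s:{0..}. G x (\<i> * R s)) + (CLBINT r:{0..}. G x (- R r))) at_top"
    by (intro tendsto_intros tendsto_set_lebesgue_integral_at_top set_integrable_G_imaginary
        set_integrable_G_negative assms) auto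
  ultimately have "\<i> * (CLBINT s:{0..}. G x (\<i> * R s)) + (CLBINT r:{0..}. G x (- R r)) = - (0 + 0)"
    by (intro tendsto_unique[rotated]) auto
  \<comment> \<open>The imaginary part of \<open>\<i> * I + J\<close> is \<open>Re I + Im J\<close>,
    which isolates the real part that the density needs.\<close>
  then have "Im (\<i> * (CLBINT s:{0..}. G x (\<i> * R s)) + (CLBINT r:{0..}. G x (- R r))) = 0"
    by simp
  then show ?thesis by simp
qed

section \<open>From the inversion integral to the integral over the unit interval\<close>

lemma \<Psi>_cnj:
  assumes "Re u \<ge> 0"
  shows "\<Psi> (cnj u) = cnj (\<Psi> u)"
proof -
  have "cnj ((R b + u) powr (R c + 1)) = (R b + cnj u) powr (R c + 1)"
    using assms b by (subst cnj_powr) auto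
  then show ?thesis by (simp add: \<Psi>_def)
qed

text \<open>The characteristic function evaluates the transform at \<open>- \<i> * \<theta>\<close>,
  whereas the contour uses the upper half of the imaginary axis; conjugation matches the two. The
  real part is even in \<theta>, so folding the line turns \<open>1 / (2 * pi)\<close> into
  \<open>1 / pi\<close>.\<close>

lemma fourier_density_eq:
  assumes "x > 0" and \<phi>: "\<And>\<theta>. \<phi> \<theta> = exp (\<Psi> (- \<i> * R \<theta>))" and int: "integrable lborel \<phi>"
  shows "fourier_density \<phi> x = 1 / pi * - (LBINT r:{0..}. Im (G x (- R r)))"
proof -
  have G: "iexp (- (\<theta> * x)) * \<phi> \<theta> = cnj (G x (\<i> * R \<theta>))" for \<theta>
  proof -
    have "\<Psi> (cnj (\<i> * R \<theta>)) = cnj (\<Psi> (\<i> * R \<theta>))"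
      by (rule \<Psi>_cnj) simp
    then show ?thesis
      by (simp add: \<phi> G_def exp_add exp_cnj mult_ac)
  qed
  have "integrable lborel (\<lambda>\<theta>. iexp (- (\<theta> * x)) * \<phi> \<theta>)"
    by (rule Bochner_Integration.integrable_bound[OF int])
       (use borel_measurable_integrable[OF int] in \<open>auto simp: norm_mult\<close>)
  then have i: "integrable lborel (\<lambda>\<theta>. cnj (G x (\<i> * R \<theta>)))"
    by (simp only: G)
  have even: "Re (G x (\<i> * R (- s))) = Re (G x (\<i> * R s))" for s
  proof -
    have "\<Psi> (cnj (\<i> * R s)) = cnj (\<Psi> (\<i> * R s))"
      by (rule \<Psi>_cnj) simp
    then have "G x (\<i> * R (- s)) = cnj (G x (\<i> * R s))"
      by (simp add: G_def exp_cnj)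
    then show ?thesis by simp
  qed
  have "Re (CLBINT \<theta>. iexp (- (\<theta> * x)) * \<phi> \<theta>) = (LBINT \<theta>. Re (G x (\<i> * R \<theta>)))"
    unfolding G using i by (subst integral_Re[symmetric]) auto
  also have "\<dots> = 2 * (LBINT s:{0..}. Re (G x (\<i> * R s)))"
    using integrable_Re[OF i] even by (intro integral_even) auto
  also have "(LBINT s:{0..}. Re (G x (\<i> * R s))) = Re (CLBINT s:{0..}. G x (\<i> * R s))"
    using set_integrable_G_imaginary[of x] unfolding set_integrable_def set_lebesgue_integral_def
    by (subst integral_Re[symmetric]) auto
  also have "\<dots> = - Im (CLBINT r:{0..}. G x (- R r))"
    by (rule imaginary_eq_negative_axis[OF assms(1)])
  also have "Im (CLBINT r:{0..}. G x (- R r)) = (LBINT r:{0..}. Im (G x (- R r)))"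
    using set_integrable_G_negative[OF assms(1)] unfolding set_integrable_def set_lebesgue_integral_def
    by (subst integral_Im[symmetric]) auto
  finally show ?thesis by (simp add: fourier_density_def)
qed

text \<open>Up to \<open>b\<close> the base \<open>b - r\<close> is nonnegative and everything is
  real. Beyond it \<open>b - r\<close> has argument \<open>pi\<close>, and the power
  \<open>c + 1\<close> contributes \<open>exp (\<i> * pi * (c + 1)) = - cis (pi * c)\<close>; this
  is the only source of an imaginary part.\<close>

lemma Im_G_negative:
  assumes "r > 0"
  shows "Im (G x (- R r)) = (if r \<le> b then 0 else
    - exp (K * (c + 1) * b powr c - K * ((r - b) powr (c + 1) * cos (pi * c) + b powr (c + 1)) / r - r * x)
      * sin (K * (r - b) powr (c + 1) * sin (pi * c) / r))"
proof (cases "r \<le> b")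
  case True
  then have "(R b - R r) powr (R c + 1) = R ((b - r) powr (c + 1))"
    using powr_of_real[of "b - r" "c + 1"] by simp
  then have "\<Psi> (- R r) \<in> \<real>" using assms by (simp add: \<Psi>_def)
  then have "G x (- R r) \<in> \<real>" by (auto simp: G_def elim!: Reals_cases simp flip: exp_of_real of_real_minus of_real_mult of_real_add)
  then show ?thesis using True by (auto simp: complex_is_Real_iff)
next
  case False
  then have rb: "r > b" by simp
  have "(R b - R r) powr (R c + 1) = exp ((R c + 1) * (R (ln (r - b)) + \<i> * R pi))"
  proof -
    \<comment> \<open>The principal value adds \<open>+ \<i> * pi\<close> on the negative axis, the
      boundary value from the side on which the contour lies.\<close>
    have "Ln (- R (r - b)) = Ln (R (r - b)) + \<i> * R pi"
      using rb by (subst Ln_minus) (auto simp: mult.commute)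
    then have "Ln (R b - R r) = R (ln (r - b)) + \<i> * R pi"
      using rb by (simp add: Ln_of_real[symmetric])
    then show ?thesis using rb by (simp add: powr_def)
  qed
  also have "\<dots> = exp (R ((c + 1) * ln (r - b))) * exp (\<i> * R (pi * c) + \<i> * R pi)"
    by (simp add: exp_add[symmetric] algebra_simps)
  also have "\<dots> = - (R ((r - b) powr (c + 1)) * cis (pi * c))"
    using rb unfolding exp_add by (simp add: cis_conv_exp powr_def flip: exp_of_real)
  finally have p: "(R b - R r) powr (R c + 1) = - (R ((r - b) powr (c + 1)) * cis (pi * c))" .
  have Psi: "\<Psi> (- R r) = R K * (R ((c + 1) * b powr c) - (R ((r - b) powr (c + 1)) * cis (pi * c) + R (b powr (c + 1))) / R r)"
  proof -
    have "(- X - B) / (- r) = (X + B) / r" for X B r :: complex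
      using minus_divide_divide[of "X + B" r] by simp
    moreover have "\<Psi> (- R r) =
        R K * (R ((c + 1) * b powr c) - ((R b - R r) powr (R c + 1) - R (b powr (c + 1))) / (- R r))"
      using assms by (simp add: \<Psi>_def)
    ultimately show ?thesis by (simp only: p)
  qed
  have "Re (\<Psi> (- R r)) = K * (c + 1) * b powr c - K * ((r - b) powr (c + 1) * cos (pi * c) + b powr (c + 1)) / r"
    "Im (\<Psi> (- R r)) = - (K * (r - b) powr (c + 1) * sin (pi * c) / r)"
    unfolding Psi by (simp_all add: Re_divide_of_real Im_divide_of_real algebra_simps)
  then show ?thesis using False by (simp add: G_def Im_exp algebra_simps)
qed

text \<open>The substitution \<open>r = b / y\<close> maps the unit interval onto the part of the
  axis beyond the branch point. Its Jacobian \<open>b / y\<^sup>2\<close> gives both the leading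
  \<open>b\<close> and the weight \<open>1 / y\<^sup>2\<close>.\<close>

lemma negative_axis_substitution:
  assumes "x > 0"
  defines "g \<equiv> \<lambda>y. 1 / y\<^sup>2 *
      exp (- (K * b powr c) * (y + cos (pi * c) * (1 - y) * (1 / y - 1) powr c) - b * x / y) *
      sin (K * b powr c * sin (pi * c) * (1 - y) * (1 / y - 1) powr c)"
  shows "set_integrable lborel {0<..<1} g"
    and "- (LBINT r:{0..}. Im (G x (- R r))) = b * exp (K * (c + 1) * b powr c) * (LBINT y:{0<..<1}. g y)"
proof -
  define q where "q r = - Im (G x (- R r))" for r
  define C where "C = b * exp (K * (c + 1) * b powr c)"
  have C: "C > 0" using b by (simp add: C_def)
  have q0: "set_integrable lborel {0..} q"
    using set_integrable_G_negative[OF assms(1)] unfolding q_def set_integrable_def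
    by (drule_tac integrable_Im) simp
  have q1: "set_integrable lborel {b<..} q"
    by (rule set_integrable_subset[OF q0]) (use b in auto)
  have "(LBINT r:{0..}. q r) = (LBINT r:{b<..}. q r)"
    unfolding set_lebesgue_integral_def
  proof (rule integral_cong_AE)
    \<comment> \<open>\<open>Im_G_negative\<close> speaks of \<open>r > 0\<close> only, so the
      origin is dropped as a null set; on the rest of the range up to \<open>b\<close> the integrand
      vanishes.\<close>
    show "AE r in lborel. indicat_real {0..} r *\<^sub>R q r = indicat_real {b<..} r *\<^sub>R q r"
      using AE_lborel_singleton[of 0]
      by eventually_elim (use b in \<open>auto simp: indicator_def q_def Im_G_negative\<close>)
  qed (use q0 q1 in \<open>auto simp: set_integrable_def\<close>)
  also have "\<dots> = integral {b<..} q"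
    by (rule set_borel_integral_eq_integral(2)[OF q1])
  finally have q2: "(LBINT r:{0..}. q r) = integral {b<..} q" .
  have img: "(\<lambda>y. b / y) ` {0<..<1} = {b<..}"
  proof safe
    fix r assume "r > b"
    then show "r \<in> (\<lambda>y. b / y) ` {0<..<1}"
      using b by (intro image_eqI[of _ _ "b / r"]) auto
  qed (use b in \<open>auto simp: field_simps\<close>)
  \<comment> \<open>The change of variables is stated for completed Lebesgue measure. Borel
    measurability carries integrability of \<open>q\<close> over to it here and that of
    \<open>g\<close> back at the end.\<close>
  have q3: "q absolutely_integrable_on {b<..}"
    using q1 borel_measurable_integrable[OF q1[unfolded set_integrable_def]]
    unfolding set_integrable_def by (subst integrable_completion) (simp_all only: measurable_lborel1)
  have sub: "\<bar>- b / y\<^sup>2\<bar> * q (b / y) = C * g y" if "y \<in> {0<..<1}" for y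
  proof -
    have y: "0 < y" "y < 1" using that by auto
    have r: "b / y > b" "b / y > 0" using y b by (auto simp: field_simps)
    have "(b / y - b) = b * (1 / y - 1)" by (simp add: algebra_simps)
    then have p: "(b / y - b) powr (c + 1) = b powr c * b * ((1 / y - 1) powr c * (1 / y - 1))"
      using y b by (simp add: powr_mult powr_add)
    \<comment> \<open>One factor \<open>1 / y - 1\<close> of the power meets the \<open>y\<close>
      coming from \<open>1 / r\<close> and becomes \<open>1 - y\<close>; the rest keeps exponent
      \<open>c\<close>.\<close>
    have e: "(b / y - b) powr (c + 1) / (b / y) = b powr c * ((1 - y) * (1 / y - 1) powr c)"
      unfolding p using y b by (simp add: field_simps)
    have e2: "b powr (c + 1) / (b / y) = b powr c * y"
      using b y by (simp add: powr_add)
    have 1: "K * ((b / y - b) powr (c + 1) * cos (pi * c) + b powr (c + 1)) / (b / y) =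
        K * b powr c * (y + cos (pi * c) * (1 - y) * (1 / y - 1) powr c)"
    proof -
      have "K * ((b / y - b) powr (c + 1) * cos (pi * c) + b powr (c + 1)) / (b / y) =
        K * ((b / y - b) powr (c + 1) / (b / y) * cos (pi * c) + b powr (c + 1) / (b / y))"
        by (simp add: add_divide_distrib algebra_simps)
      then show ?thesis unfolding e e2 by (simp add: algebra_simps)
    qed
    have 2: "K * (b / y - b) powr (c + 1) * sin (pi * c) / (b / y) =
        K * b powr c * sin (pi * c) * (1 - y) * (1 / y - 1) powr c"
    proof -
      have "K * (b / y - b) powr (c + 1) * sin (pi * c) / (b / y) =
        K * ((b / y - b) powr (c + 1) / (b / y)) * sin (pi * c)" by simp
      then show ?thesis unfolding e by (simp add: mult_ac)
    qed
    have "q (b / y) = exp (K * (c + 1) * b powr c - K * b powr c * (y + cos (pi * c) * (1 - y) * (1 / y - 1) powr c) - b / y * x)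
        * sin (K * b powr c * sin (pi * c) * (1 - y) * (1 / y - 1) powr c)"
      unfolding q_def Im_G_negative[OF r(2)] 1 2 using r by simp
    also have "\<dots> = exp (K * (c + 1) * b powr c) * (y\<^sup>2 * g y)"
    proof -
      have "exp (A - P * W - b / y * x) = exp A * exp (- P * W - b * x / y)" for A P W
        by (simp add: exp_add[symmetric])
      then show ?thesis unfolding g_def using y by simp
    qed
    finally show ?thesis using y b by (simp add: C_def)
  qed
  have "(\<lambda>y. \<bar>- b / y\<^sup>2\<bar> * q (b / y)) absolutely_integrable_on {0<..<1} \<and>
      integral {0<..<1} (\<lambda>y. \<bar>- b / y\<^sup>2\<bar> * q (b / y)) = integral {b<..} q"
  proof (rule has_absolute_integral_change_of_variables_1'[where f=q and g="\<lambda>y. b / y"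
        and g'="\<lambda>y. - b / y\<^sup>2", THEN iffD2])
    show "((\<lambda>y. b / y) has_real_derivative - b / y\<^sup>2) (at y within {0<..<1})" if "y \<in> {0<..<1}" for y
      using that by (auto intro!: derivative_eq_intros simp: power2_eq_square)
    show "inj_on (\<lambda>y. b / y) {0<..<1}" using b by (auto simp: inj_on_def)
  qed (use q3 img in auto)
  moreover have "integral {0<..<1} (\<lambda>y. \<bar>- b / y\<^sup>2\<bar> * q (b / y)) = integral {0<..<1} (\<lambda>y. C * g y)"
    by (rule integral_cong) (rule sub)
  moreover have "(\<lambda>y. \<bar>- b / y\<^sup>2\<bar> * q (b / y)) absolutely_integrable_on {0<..<1} \<longleftrightarrow>
      (\<lambda>y. C * g y) absolutely_integrable_on {0<..<1}"
    unfolding set_integrable_def by (intro Bochner_Integration.integrable_cong refl) (metis (no_types, lifting) indicator_simps(2) scaleR_zero_left sub)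
  ultimately have i: "(\<lambda>y. C * g y) absolutely_integrable_on {0<..<1}"
    "integral {0<..<1} (\<lambda>y. C * g y) = integral {b<..} q" by auto
  have "set_integrable lborel {0<..<1} (\<lambda>y. C * g y)"
    using i(1) unfolding set_integrable_def
    by (rule integrable_completion[THEN iffD1, rotated]) (auto simp: g_def)
  then have "set_integrable lborel {0<..<1} (\<lambda>y. 1 / C * (C * g y))"
    by (rule set_integrable_mult_right)
  then show s: "set_integrable lborel {0<..<1} g"
    using C by simp
  have "(LBINT r:{0..}. q r) = C * (LBINT y:{0<..<1}. g y)"
    using q2 i(2) set_borel_integral_eq_integral(2)[OF s] by simp
  then show "- (LBINT r:{0..}. Im (G x (- R r))) = b * exp (K * (c + 1) * b powr c) * (LBINT y:{0<..<1}. g y)"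
    by (simp add: q_def C_def set_lebesgue_integral_def)
qed

end

section \<open>The characteristic function of the time average\<close>

text \<open>Abel summation: increment \<open>i\<close> is contained in \<open>Y k\<close> for every
  \<open>k\<close> from \<open>i + 1\<close> to \<open>n\<close>, that is \<open>n - i\<close>
  times. It makes independence of increments applicable to a sum of dependent values.\<close>

lemma sum_eq_weighted_increments:
  fixes Y :: "nat \<Rightarrow> real"
  shows "(\<Sum>k=1..n. Y k) = real n * Y 0 + (\<Sum>i<n. (real n - real i) * (Y (Suc i) - Y i))"
proof (induction n)
  case (Suc n)
  have "(\<Sum>i<Suc n. (real (Suc n) - real i) * (Y (Suc i) - Y i)) =
      (\<Sum>i<Suc n. (real n - real i) * (Y (Suc i) - Y i)) + (\<Sum>i<Suc n. Y (Suc i) - Y i)"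
    unfolding sum.distrib[symmetric] by (intro sum.cong) (auto simp: algebra_simps)
  also have "(\<Sum>i<Suc n. Y (Suc i) - Y i) = Y (Suc n) - Y 0"
    by (rule sum_lessThan_telescope)
  finally show ?case using Suc by (simp add: algebra_simps)
qed simp

lemma (in prob_space) char_distr:
  assumes "random_variable borel X"
  shows "char (distr M borel X) \<theta> = (CLINT \<omega>|M. iexp (\<theta> * X \<omega>))"
  unfolding char_def using assms by (subst integral_distr) auto

context levy_process
begin

definition grid_average :: "real \<Rightarrow> nat \<Rightarrow> 'a \<Rightarrow> real" where
  "grid_average t n \<omega> = (\<Sum>k=1..n. X (real k * t / real n) \<omega>) / real n"

lemma grid_average_measurable [measurable]:
  "t \<ge> 0 \<Longrightarrow> grid_average t n \<in> borel_measurable M"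
  unfolding grid_average_def
  by (intro borel_measurable_divide borel_measurable_sum borel_measurable_const random_variable) auto

lemma grid_average_tendsto:
  assumes "t > 0" "\<omega> \<in> space M"
  shows "(\<lambda>n. grid_average t n \<omega>) \<longlonglongrightarrow> time_average X t \<omega>"
proof -
  have "bounded ((\<lambda>s. X s \<omega>) ` {0..t})"
    using assms right_continuous left_limits by (intro cadlag_bounded) auto
  then obtain B where "\<And>s. s \<in> {0..t} \<Longrightarrow> norm (X s \<omega>) \<le> B"
    unfolding bounded_iff by blast
  then have "(\<lambda>n. (t / real n) *\<^sub>R (\<Sum>k=1..n. X (real k * t / real n) \<omega>))
      \<longlonglongrightarrow> (LBINT s:{0..t}. X s \<omega>)"
    using assms right_continuous by (intro riemann_sum_right_continuous[where B=B]) auto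
  then have "(\<lambda>n. 1 / t * ((t / real n) *\<^sub>R (\<Sum>k=1..n. X (real k * t / real n) \<omega>)))
      \<longlonglongrightarrow> 1 / t * (LBINT s:{0..t}. X s \<omega>)"
    by (intro tendsto_mult tendsto_const)
  moreover have "1 / t * ((t / real n) *\<^sub>R (\<Sum>k=1..n. X (real k * t / real n) \<omega>)) = grid_average t n \<omega>" for n
    using assms by (simp add: grid_average_def)
  ultimately show ?thesis by (simp add: time_average_def)
qed

text \<open>Measurability in \<omega> is inherited from the grid averages, which converge at every
  point of the space.\<close>

lemma time_average_measurable:
  assumes "t > 0"
  shows "time_average X t \<in> borel_measurable M"
  by (rule borel_measurable_LIMSEQ_real[of M "\<lambda>n. grid_average t n"])
     (use assms grid_average_tendsto in auto)

lemma char_time_average_limit: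
  assumes "t > 0"
  shows "(\<lambda>n. char (distr M borel (grid_average t n)) \<theta>) \<longlonglongrightarrow>
    char (distr M borel (time_average X t)) \<theta>"
proof -
  note [measurable] = time_average_measurable[OF assms]
  have "(\<lambda>n. CLINT \<omega>|M. iexp (\<theta> * grid_average t n \<omega>)) \<longlonglongrightarrow> (CLINT \<omega>|M. iexp (\<theta> * time_average X t \<omega>))"
  proof (rule integral_dominated_convergence[where w="\<lambda>_. 1"])
    show "AE \<omega> in M. (\<lambda>n. iexp (\<theta> * grid_average t n \<omega>)) \<longlonglongrightarrow> iexp (\<theta> * time_average X t \<omega>)"
      using grid_average_tendsto[OF assms] by (intro AE_I2 tendsto_intros) auto
  qed (use assms in auto)
  then show ?thesis using assms by (simp add: char_distr)
qed

text \<open>The grid average is a weighted sum of independent increments, each distributed like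
  \<open>X (t / n)\<close> up to the almost surely vanishing \<open>X 0\<close>. The weight of an
  increment becomes a rescaling of \<theta>.\<close>

lemma char_grid_average:
  assumes "t > 0" "n > 0"
  shows "char (distr M borel (grid_average t n)) \<theta> =
    (\<Prod>k=1..n. char (distr M borel (X (t / real n))) (\<theta> * (real k / real n)))"
proof -
  let ?\<tau> = "\<lambda>i. real i * t / real n"
  let ?D = "\<lambda>i \<omega>. X (?\<tau> (Suc i)) \<omega> - X (?\<tau> i) \<omega>"
  let ?w = "\<lambda>i. (real n - real i) / real n"
  have \<tau>: "?\<tau> i \<ge> 0" for i using assms by simp
  have D [measurable]: "?D i \<in> borel_measurable M" for i
    by (intro borel_measurable_diff random_variable \<tau>)
  have X0: "X 0 \<in> borel_measurable M" "X (t / real n) \<in> borel_measurable M"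
    using random_variable assms by auto
  have grid: "grid_average t n \<omega> = X 0 \<omega> + (\<Sum>i<n. ?w i * ?D i \<omega>)" for \<omega>
  proof -
    have "grid_average t n \<omega> = (real n * X (?\<tau> 0) \<omega> + (\<Sum>i<n. (real n - real i) * ?D i \<omega>)) / real n"
      unfolding grid_average_def using sum_eq_weighted_increments[of "\<lambda>i. X (?\<tau> i) \<omega>" n] by simp
    then show ?thesis using assms by (simp add: add_divide_distrib sum_divide_distrib)
  qed
  define S where "S = (\<lambda>\<omega>. \<Sum>i<n. ?w i * ?D i \<omega>)"
  have S [measurable]: "S \<in> borel_measurable M"
    unfolding S_def by (intro borel_measurable_sum borel_measurable_times borel_measurable_const D)
  have "AE \<omega> in M. iexp (\<theta> * grid_average t n \<omega>) = iexp (\<theta> * S \<omega>)"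
    using start_zero by eventually_elim (simp add: grid S_def)
  then have "char (distr M borel (grid_average t n)) \<theta> = char (distr M borel S) \<theta>"
    using assms S by (subst (1 2) char_distr) (auto intro!: integral_cong_AE)
  also have "\<dots> = (\<Prod>i<n. char (distr M borel (\<lambda>\<omega>. ?w i * ?D i \<omega>)) \<theta>)"
    unfolding S_def
  proof (rule char_distr_sum)
    have "indep_vars (\<lambda>_. borel) ?D {..<n}"
      using assms by (intro indep_increments) (auto simp: divide_strict_right_mono)
    then show "indep_vars (\<lambda>_. borel) (\<lambda>i \<omega>. ?w i * ?D i \<omega>) {..<n}"
      by (rule indep_vars_compose2) auto
  qed
  also have "\<dots> = (\<Prod>i<n. char (distr M borel (X (t / real n))) (\<theta> * ?w i))"
  proof (rule prod.cong[OF refl])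
    fix i
    have "char (distr M borel (\<lambda>\<omega>. ?w i * ?D i \<omega>)) \<theta> = char (distr M borel (?D i)) (\<theta> * ?w i)"
      by (subst char_distr[OF D], subst char_distr)
         (intro borel_measurable_times borel_measurable_const D, simp only: mult.assoc)
    also have "distr M borel (?D i) = distr M borel (\<lambda>\<omega>. X (t / real n) \<omega> - X 0 \<omega>)"
      using stationary_increments[of "?\<tau> i" "t / real n"] assms by (simp add: add_divide_distrib algebra_simps)
    also have "char (distr M borel (\<lambda>\<omega>. X (t / real n) \<omega> - X 0 \<omega>)) (\<theta> * ?w i) =
        char (distr M borel (X (t / real n))) (\<theta> * ?w i)"
    proof -
      have "AE \<omega> in M. iexp (\<theta> * ?w i * (X (t / real n) \<omega> - X 0 \<omega>)) = iexp (\<theta> * ?w i * X (t / real n) \<omega>)"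
        using start_zero by eventually_elim simp
      then show ?thesis
        using X0 by (subst (1 2) char_distr) (auto intro!: integral_cong_AE)
    qed
    finally show "char (distr M borel (\<lambda>\<omega>. ?w i * ?D i \<omega>)) \<theta> =
        char (distr M borel (X (t / real n))) (\<theta> * ?w i)" .
  qed
  \<comment> \<open>Reversing the order by \<open>k = n - i\<close> turns the weights
    \<open>(n - i) / n\<close> into the equidistant nodes \<open>k / n\<close> of a Riemann
    sum.\<close>
  also have "\<dots> = (\<Prod>k=1..n. char (distr M borel (X (t / real n))) (\<theta> * (real k / real n)))"
    by (rule prod.reindex_bij_witness[where i="\<lambda>k. n - k" and j="\<lambda>i. n - i"]) (auto simp: of_nat_diff)
  finally show ?thesis .
qed

end

section \<open>The sign of the gamma factor and the assembly\<close>

text \<open>Two steps of the recurrence give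
  \<open>Gamma (1 - c) = c * (c + 1) * Gamma (- c - 1)\<close>, with all arguments strictly between
  poles, and the left side is positive.\<close>

lemma Gamma_shift_pos:
  fixes c :: real
  assumes "0 < c" "c < 1"
  shows "Gamma (- c - 1) > 0" "Gamma (- c) = - ((c + 1) * Gamma (- c - 1))"
proof -
  have n: "- c \<notin> \<int>\<^sub>\<le>\<^sub>0" "- c - 1 \<notin> \<int>\<^sub>\<le>\<^sub>0"
  proof -
    show "- c \<notin> \<int>\<^sub>\<le>\<^sub>0"
    proof
      assume "- c \<in> \<int>\<^sub>\<le>\<^sub>0"
      then obtain k :: int where "- c = of_int k" by (auto simp: nonpos_Ints_def)
      then have "- 1 < k" "k < 0" using assms by linarith+
      then show False by simp
    qed
    show "- c - 1 \<notin> \<int>\<^sub>\<le>\<^sub>0"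
    proof
      assume "- c - 1 \<in> \<int>\<^sub>\<le>\<^sub>0"
      then obtain k :: int where "- c - 1 = of_int k" by (auto simp: nonpos_Ints_def)
      then have "- 2 < k" "k < - 1" using assms by linarith+
      then show False by simp
    qed
  qed
  show 1: "Gamma (- c) = - ((c + 1) * Gamma (- c - 1))"
    using Gamma_plus1[OF n(2)] by (simp add: algebra_simps)
  have "Gamma (1 - c) = - c * Gamma (- c)"
    using Gamma_plus1[OF n(1)] by (simp add: algebra_simps)
  then have "c * (c + 1) * Gamma (- c - 1) > 0"
    using Gamma_real_pos[of "1 - c"] assms unfolding 1 by simp
  then show "Gamma (- c - 1) > 0"
    by (rule zero_less_mult_pos) (use assms in simp)
qed

lemma (in tempered_stable_subordinator) char_time_average:
  assumes "a > 0" "b > 0" "0 < c" "c < 1" "t > 0"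
  defines "K \<equiv> a * t * Gamma (- c - 1)"
  shows "char (distr M borel (time_average X t)) \<theta> = exp (averaged_exponent.\<Psi> K b c (- \<i> * \<theta>))"
proof -
  have K: "K > 0" unfolding K_def using assms Gamma_shift_pos[of c] by simp
  interpret E: averaged_exponent K b c
    using K assms by unfold_locales
  \<comment> \<open>This is the Laplace transform at an imaginary point, allowed since
    \<open>0 > - b\<close>. Linearity of the exponent in time yields the division by
    \<open>n\<close>.\<close>
  have char_X: "char (distr M borel (X (t / real n))) (\<theta> * v) =
      exp (E.\<psi> (- \<i> * \<theta> * complex_of_real v) / complex_of_real n)" if "n > 0" for n v
  proof -
    let ?u = "- \<i> * complex_of_real (\<theta> * v)"
    have "char (distr M borel (X (t / real n))) (\<theta> * v) = (CLINT \<omega>|M. exp (- ?u * complex_of_real (X (t / real n) \<omega>)))"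
      using assms random_variable by (subst char_distr) (auto simp: mult_ac)
    also have "\<dots> = exp (complex_of_real (a * (t / real n) * Gamma (- c)) *
          ((complex_of_real b + ?u) powr complex_of_real c
            - complex_of_real b powr complex_of_real c))"
      using laplace_transform[of ?u "t / real n"] assms
      by (intro has_bochner_integral_integral_eq) auto
    also have "a * (t / real n) * Gamma (- c) = - (K * (c + 1)) / real n"
      using Gamma_shift_pos(2)[of c] assms(3,4) by (simp add: K_def mult_ac)
    also have "complex_of_real (- (K * (c + 1)) / real n) * ((complex_of_real b + ?u) powr complex_of_real c
            - complex_of_real b powr complex_of_real c) = E.\<psi> (- \<i> * \<theta> * complex_of_real v) / complex_of_real n"
      using assms(2) by (simp add: E.\<psi>_def powr_of_real mult_ac)
    finally show ?thesis .
  qed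
  have cont: "continuous_on {0..1} (\<lambda>s. E.\<psi> (- \<i> * \<theta> * complex_of_real s))"
    using E.continuous_on_\<psi>[of "- \<i> * \<theta>" 1 1] by simp
  then have "bounded ((\<lambda>s. E.\<psi> (- \<i> * \<theta> * complex_of_real s)) ` {0..1})"
    by (intro compact_imp_bounded compact_continuous_image) auto
  then obtain B where B: "\<And>s. s \<in> {0..1} \<Longrightarrow> norm (E.\<psi> (- \<i> * \<theta> * complex_of_real s)) \<le> B"
    unfolding bounded_iff by blast
  \<comment> \<open>The product of exponentials at the nodes \<open>k / n\<close> is the exponential
    of this Riemann sum.\<close>
  have "(\<lambda>n. (1 / real n) *\<^sub>R (\<Sum>k=1..n. E.\<psi> (- \<i> * \<theta> * complex_of_real (real k * 1 / real n))))
      \<longlonglongrightarrow> (CLBINT s:{0..1}. E.\<psi> (- \<i> * \<theta> * complex_of_real s))"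
  proof (rule riemann_sum_right_continuous)
    fix s :: real assume s: "0 \<le> s" "s < 1"
    have "continuous_on {s..1} (\<lambda>s. E.\<psi> (- \<i> * \<theta> * complex_of_real s))"
      using s by (intro continuous_on_subset[OF cont]) auto
    then show "continuous (at_right s) (\<lambda>s. E.\<psi> (- \<i> * \<theta> * complex_of_real s))"
      unfolding continuous_within by (rule continuous_on_Icc_at_rightD) (use s in simp)
  qed (use B in auto)
  also have "(CLBINT s:{0..1}. E.\<psi> (- \<i> * \<theta> * complex_of_real s)) = E.\<Psi> (- \<i> * \<theta>)"
    using E.\<Psi>_eq_integral[of "- \<i> * \<theta>" 1] by simp
  finally have "(\<lambda>n. exp ((1 / real n) *\<^sub>R (\<Sum>k=1..n. E.\<psi> (- \<i> * \<theta> * complex_of_real (real k * 1 / real n)))))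
      \<longlonglongrightarrow> exp (E.\<Psi> (- \<i> * \<theta>))"
    by (rule tendsto_exp)
  moreover have "\<forall>\<^sub>F n in sequentially.
      exp ((1 / real n) *\<^sub>R (\<Sum>k=1..n. E.\<psi> (- \<i> * \<theta> * complex_of_real (real k * 1 / real n)))) =
      char (distr M borel (grid_average t n)) \<theta>"
    using eventually_gt_at_top[of 0]
  proof eventually_elim
    case (elim n)
    have "char (distr M borel (grid_average t n)) \<theta> =
        (\<Prod>k=1..n. exp (E.\<psi> (- \<i> * \<theta> * complex_of_real (real k / real n)) / complex_of_real n))"
      using elim assms by (simp only: char_grid_average char_X)
    also have "\<dots> = exp (\<Sum>k=1..n. E.\<psi> (- \<i> * \<theta> * complex_of_real (real k / real n)) / complex_of_real n)"
      by (simp only: exp_sum finite_atLeastAtMost)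
    finally show ?case
      by (simp add: scaleR_conv_of_real sum_divide_distrib)
  qed
  ultimately have "(\<lambda>n. char (distr M borel (grid_average t n)) \<theta>) \<longlonglongrightarrow> exp (E.\<Psi> (- \<i> * \<theta>))"
    by (rule Lim_transform_eventually)
  from LIMSEQ_unique[OF char_time_average_limit[OF \<open>t > 0\<close>] this] show ?thesis .
qed

theorem theorem2:
  fixes M :: "'a measure" and X :: "real \<Rightarrow> 'a \<Rightarrow> real" and a b c t :: real
  assumes "a > 0" and "b > 0" and "0 < c" and "c < 1"
    and "tempered_stable_subordinator M X a b c"
    and "t > 0"
  shows "\<exists>f :: real \<Rightarrow> real.
    (\<forall>x. f x \<ge> 0) \<and>
    distributed M lborel (time_average X t) (\<lambda>x. ennreal (f x)) \<and>
    (\<forall>x>0.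
      let g = (\<lambda>y :: real. 1 / y\<^sup>2 *
        exp (- a * t * b powr c * Gamma (- c - 1) *
               (y + cos (pi * c) * (1 - y) * (1 / y - 1) powr c) - b * x / y) *
        sin (a * t * b powr c * sin (pi * c) * Gamma (- c - 1) *
               (1 - y) * (1 / y - 1) powr c))
      in set_integrable lborel {0<..<1} g \<and>
         f x = b * exp (- a * t * b powr c * Gamma (- c)) / pi * (LBINT y:{0<..<1}. g y))"
proof -
  interpret tempered_stable_subordinator M X a b c by fact
  define K where "K = a * t * Gamma (- c - 1)"
  have "K > 0" unfolding K_def using assms Gamma_shift_pos[of c] by simp
  then interpret E: averaged_exponent K b c
    using assms by unfold_locales
  let ?N = "distr M borel (time_average X t)"
  have meas: "time_average X t \<in> borel_measurable M"
    by (rule time_average_measurable) fact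
  interpret N: real_distribution ?N
    using meas by simp
  have char: "char ?N \<theta> = exp (E.\<Psi> (- \<i> * complex_of_real \<theta>))" for \<theta>
    unfolding K_def by (rule char_time_average) fact+
  have int: "integrable lborel (char ?N)"
  proof (rule Bochner_Integration.integrable_bound[OF E.integrable_imaginary_bound])
    show "0 < K * (c + 1) * cos (c * pi / 2) / 2"
      using E.K E.c E.cos_pos by simp
    show "AE \<theta> in lborel. norm (char ?N \<theta>) \<le>
        norm (exp (K * (c + 1) * b powr c - K * (c + 1) * cos (c * pi / 2) / 2 * \<bar>\<theta>\<bar> powr c))"
    proof (rule AE_I2)
      fix \<theta> :: real
      show "norm (char ?N \<theta>) \<le>
          norm (exp (K * (c + 1) * b powr c - K * (c + 1) * cos (c * pi / 2) / 2 * \<bar>\<theta>\<bar> powr c))"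
        using E.norm_exp_\<Psi>_imaginary[of "- \<theta>"] unfolding char by simp
    qed
  qed simp
  let ?f = "fourier_density (char ?N)"
  have "distributed M lborel (time_average X t) (\<lambda>x. ennreal (?f x))"
  proof -
    have "distr M lborel (time_average X t) = ?N"
      by (rule distr_cong) auto
    moreover have "?f \<in> borel_measurable borel"
      by (intro borel_measurable_continuous_onI continuous_at_imp_continuous_on ballI isCont_fourier_density int)
    ultimately show ?thesis
      using N.density_of_integrable_char(1)[OF int] meas by (simp add: distributed_def)
  qed
  moreover have "?f x \<ge> 0" for x
    by (rule N.density_of_integrable_char(2)[OF int])
  moreover have "let g = (\<lambda>y :: real. 1 / y\<^sup>2 *
        exp (- a * t * b powr c * Gamma (- c - 1) *
               (y + cos (pi * c) * (1 - y) * (1 / y - 1) powr c) - b * x / y) *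
        sin (a * t * b powr c * sin (pi * c) * Gamma (- c - 1) *
               (1 - y) * (1 / y - 1) powr c))
      in set_integrable lborel {0<..<1} g \<and>
         ?f x = b * exp (- a * t * b powr c * Gamma (- c)) / pi * (LBINT y:{0<..<1}. g y)" if "x > 0" for x
  proof -
    have 1: "- a * t * b powr c * Gamma (- c - 1) = - (K * b powr c)"
      by (simp add: K_def)
    have 2: "a * t * b powr c * sin (pi * c) * Gamma (- c - 1) = K * b powr c * sin (pi * c)"
      by (simp add: K_def)
    \<comment> \<open>The recurrence for \<open>Gamma\<close> flips the sign, so the prefactor is
      the exponential of the constant term of \<Psi>.\<close>
    have 3: "- a * t * b powr c * Gamma (- c) = K * (c + 1) * b powr c"
      using Gamma_shift_pos(2)[of c] assms(3,4) by (simp add: K_def mult_ac)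
    show ?thesis
      unfolding Let_def 1 2 3
      using E.negative_axis_substitution(1)[OF that]
        E.fourier_density_eq[OF that char int, unfolded E.negative_axis_substitution(2)[OF that]]
      by simp
  qed
  ultimately show ?thesis by blast
qed

end
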